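(* Let $T\ge2$, $R\ge0$, and let $K_0$ be a tracking gain with $\Lambda(K_0)<\infty$. For globally $L$-Lipschitz convex costs, exact-prefix mirror descent with counterfactual tracking (described in the context) satisfies $$\mathrm{Reg}_T(\mathfrak S(R))\le eLWR\sqrt{T\bigl(1+2\chi_0\Lambda_x(K_0)\bigr)\log(eT)}.$$ For $(G,D_R)$-regular convex costs, the same bound holds with $L=GD_R$ (the algorithm being run with this $L$), where $$D_R=W\left[S_0+eR\bigl(1+2\chi_0\Lambda_x(K_0)\bigr)\right],\qquad S_0=\sum_{i\ge1}\|\Phi_0^{[i]}\|_{\rm F}.$$
   Context: Model: $A\in\mathbb R^{d_x\times d_x}$, $B\in\mathbb R^{d_x\times d_u}$ are known; $x_1=0$ and $x_{t+1}=Ax_t+Bu_t+w_t$ with $\|w_t\|\le W$. On round $t=1,\dots,T$ the learner observes $x_t$, chooses $u_t$, incurs $c_t(x_t,u_t)$, then observes the whole function $c_t$ and $x_{t+1}$ (hence $w_t$). The environment may choose $c_t,w_t$ as a function of previously revealed history but not of the current action; bounds are pathwise. $\|\cdot\|$ is Euclidean, $\|(x,u)\|^2=\|x\|^2+\|u\|^2$. Globally $L$-Lipschitz: $|c_t(y)-c_t(y')|\le L\|y-y'\|$ for all $y,y'$. A convex cost is $(G,D)$-regular if it is differentiable with $\|\nabla c_t\|\le GD$ on the radius-$D$ ball. Tracker: $F_0=A-BK_0$, $\Lambda(K_0)=\sum_{r\ge0}\left\|\begin{bmatrix} I \\ -K_0 \end{bmatrix}F_0^r\right\|_{\rm op}$,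 $\Lambda_x(K_0)=\sum_{r\ge0}\|F_0^r\|_{\rm op}$, $\chi_0=\sqrt{1+\|K_0\|_{\rm op}^2}$. Response ball: a response is a sequence of blocks $\Phi^{[i]}=[(\Phi_x^{[i]})^\top,(\Phi_u^{[i]})^\top]^\top$, $i\ge1$, with $\Phi_x^{[1]}=I$, $\Phi_x^{[i+1]}=A\Phi_x^{[i]}+B\Phi_u^{[i]}$. Baseline: $\Phi_{0,x}^{[i]}=F_0^{i-1}$, $\Phi_{0,u}^{[i]}=-K_0F_0^{i-1}$. $\mathfrak S(R)$ is the set of responses with $\sum_{i\ge1}\|\Phi^{[i]}-\Phi_0^{[i]}\|_{\rm F}\le R$. The trajectory of $\Phi$ on the realized disturbances is $y_t^\Phi=\sum_{i=1}^{t-1}\Phi^{[i]}w_{t-i}$, and $\mathrm{Reg}_T(\mathfrak S(R))=\sum_{t\le T}c_t(x_t,u_t)-\inf_{\Phi\in\mathfrak S(R)}\sum_{t\le T}c_t(y_t^\Phi)$. Algorithm: let $H=T-1$, $p=1+1/\log(eH)$, $\alpha=p-1$, $a_H=H^{1-1/p}$. For $Q=(Q^{[1]},\dots,Q^{[H]})$, $Q^{[i]}=\begin{bmatrix} P^{[i]} \\ {} V^{[i]} \end{bmatrix}\in\mathbb R^{(d_x+d_u)\times d_x}$, let $\|Q\|_{p,2}=(\sum_{i=1}^H\|Q^{[i]}\|_{\rm F}^p)^{1/p}$, $\mathcal V_H=\{Q:P^{[1]}=0,\ P^{[i+1]}=AP^{[i]}+BV^{[i]}\ (1\le i<H)\}$,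 $\mathcal Q_H(R)=\{Q\in\mathcal V_H:\|Q\|_{p,2}\le R\}$. Put $\bar y_t(Q)=(\bar x_t(Q),\bar u_t(Q))=\sum_{i=1}^{t-1}(\Phi_0^{[i]}+Q^{[i]})w_{t-i}$ and $f_t(Q)=c_t(\bar y_t(Q))$. Let $\Omega(Q)=\frac12\|Q\|_{p,2}^2$ with Bregman divergence $D_\Omega(Q,Q')=\Omega(Q)-\Omega(Q')-\langle\nabla\Omega(Q'),Q-Q'\rangle$, where $\langle G,Q\rangle=\sum_i\mathrm{tr}((G^{[i]})^\top Q^{[i]})$ on $\mathcal V_H$. Start from $Q_1=0$. On round $t$ play $u_t=\bar u_t(Q_t)-K_0(x_t-\bar x_t(Q_t))$; after observing $c_t$, take a subgradient $g_t$ at $Q_t$ of the restriction of $f_t$ to $\mathcal V_H$ and set $Q_{t+1}\in\arg\min_{Q\in\mathcal Q_H(R)}\{\eta\langle g_t,Q\rangle+D_\Omega(Q,Q_t)\}$, with $\eta=R\sqrt\alpha\,/\bigl(LWa_H\sqrt{T(1+2\chi_0\Lambda_x(K_0))}\bigr)$ (for $R=0$ one simply tracks the baseline $Q_t\equiv0$; if $LW=0$, $\eta>0$ is arbitrary). *)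

theory Defs
  imports "HOL-Analysis.Analysis"
begin

text \<open>
  State and input spaces are \<open>real ^ 'x\<close> and \<open>real ^ 'u\<close>. A block
  \<open>[P; V]\<close> of size \<open>(d_x + d_u) \<times> d_x\<close> is the pair \<open>(P, V)\<close>. The library norm and inner
  product on this type are the Frobenius norm and the trace inner product, and those on
  \<open>real ^ 'x \<times> real ^ 'u\<close> are the Euclidean ones for stacked vectors.

  Sequences of blocks are functions on \<^typ>\<open>nat\<close> with mathematical indices \<open>1, 2, \<dots>\<close>.
\<close>

type_synonym ('x, 'u) block = "(real ^ 'x ^ 'x) \<times> (real ^ 'x ^ 'u)"

definition block_apply ::
    "('x::finite, 'u::finite) block \<Rightarrow> real ^ 'x \<Rightarrow> (real ^ 'x) \<times> (real ^ 'u)" where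
  "block_apply \<Phi> v = (fst \<Phi> *v v, snd \<Phi> *v v)"

text \<open>The class power on \<open>real ^ 'n ^ 'n\<close> would be componentwise, hence this definition.\<close>

primrec matpow :: "real ^ 'n ^ 'n \<Rightarrow> nat \<Rightarrow> real ^ 'n ^ 'n" where
  "matpow M 0 = mat 1"
| "matpow M (Suc r) = M ** matpow M r"


subsection \<open>Tracking gain and baseline response\<close>

definition closed_loop ::
    "real ^ 'x ^ 'x \<Rightarrow> real ^ 'u ^ 'x \<Rightarrow> real ^ 'x ^ 'u \<Rightarrow> real ^ 'x ^ 'x" where
  "closed_loop A B K0 = A - B ** K0"

definition baseline ::
    "real ^ 'x ^ 'x \<Rightarrow> real ^ 'u ^ 'x \<Rightarrow> real ^ 'x ^ 'u \<Rightarrow> nat \<Rightarrow> ('x::finite, 'u::finite) block" where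
  "baseline A B K0 i =
     (matpow (closed_loop A B K0) (i - 1), - (K0 ** matpow (closed_loop A B K0) (i - 1)))"

text \<open>\<open>\<Lambda>(K\<^sub>0) < \<infinity>\<close>; the block \<open>[I; -K\<^sub>0] F\<^sub>0\<^sup>r\<close> is the baseline block with index \<open>r + 1\<close>.\<close>

definition Lambda_finite ::
    "real ^ 'x ^ 'x \<Rightarrow> real ^ 'u ^ 'x \<Rightarrow> real ^ ('x::finite) ^ ('u::finite) \<Rightarrow> bool" where
  "Lambda_finite A B K0 \<longleftrightarrow> summable (\<lambda>r. onorm (block_apply (baseline A B K0 (Suc r))))"

definition Lambda_x ::
    "real ^ 'x ^ 'x \<Rightarrow> real ^ 'u ^ 'x \<Rightarrow> real ^ ('x::finite) ^ ('u::finite) \<Rightarrow> real" where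
  "Lambda_x A B K0 = (\<Sum>r. onorm (\<lambda>v. matpow (closed_loop A B K0) r *v v))"

definition chi0 :: "real ^ ('x::finite) ^ ('u::finite) \<Rightarrow> real" where
  "chi0 K0 = sqrt (1 + (onorm (\<lambda>v. K0 *v v))\<^sup>2)"

definition kappa ::
    "real ^ 'x ^ 'x \<Rightarrow> real ^ 'u ^ 'x \<Rightarrow> real ^ ('x::finite) ^ ('u::finite) \<Rightarrow> real" where
  "kappa A B K0 = 1 + 2 * chi0 K0 * Lambda_x A B K0"

definition S0 ::
    "real ^ 'x ^ 'x \<Rightarrow> real ^ 'u ^ 'x \<Rightarrow> real ^ ('x::finite) ^ ('u::finite) \<Rightarrow> real" where
  "S0 A B K0 = (\<Sum>i. norm (baseline A B K0 (Suc i)))"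

definition D_R ::
    "real ^ 'x ^ 'x \<Rightarrow> real ^ 'u ^ 'x \<Rightarrow> real ^ ('x::finite) ^ ('u::finite) \<Rightarrow> real \<Rightarrow> real \<Rightarrow> real" where
  "D_R A B K0 W R = W * (S0 A B K0 + exp 1 * R * kappa A B K0)"


subsection \<open>Response ball and regret\<close>

text \<open>The value of a response at index \<open>0\<close> is unconstrained and never used.\<close>

definition response ::
    "real ^ 'x ^ 'x \<Rightarrow> real ^ 'u ^ 'x \<Rightarrow> (nat \<Rightarrow> ('x::finite, 'u::finite) block) \<Rightarrow> bool" where
  "response A B \<Phi> \<longleftrightarrow>
     fst (\<Phi> 1) = mat 1 \<and>
     (\<forall>i\<ge>1. fst (\<Phi> (Suc i)) = A ** fst (\<Phi> i) + B ** snd (\<Phi> i))"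

definition response_ball ::
    "real ^ 'x ^ 'x \<Rightarrow> real ^ 'u ^ 'x \<Rightarrow> real ^ 'x ^ 'u \<Rightarrow> real
      \<Rightarrow> (nat \<Rightarrow> ('x::finite, 'u::finite) block) set" where
  "response_ball A B K0 R =
     {\<Phi>. response A B \<Phi> \<and>
         summable (\<lambda>i. norm (\<Phi> (Suc i) - baseline A B K0 (Suc i))) \<and>
         (\<Sum>i. norm (\<Phi> (Suc i) - baseline A B K0 (Suc i))) \<le> R}"

definition traj ::
    "(nat \<Rightarrow> real ^ 'x) \<Rightarrow> (nat \<Rightarrow> ('x::finite, 'u::finite) block) \<Rightarrow> nat
      \<Rightarrow> (real ^ 'x) \<times> (real ^ 'u)" where
  "traj w \<Phi> t = (\<Sum>i\<in>{1..<t}. block_apply (\<Phi> i) (w (t - i)))"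

text \<open>For \<open>R \<ge> 0\<close>, \<open>\<Lambda>(K\<^sub>0) < \<infinity>\<close> and convex costs the comparator costs form a nonempty set that
  is bounded below, so the real-valued infimum is the true one.\<close>

definition regret ::
    "real ^ 'x ^ 'x \<Rightarrow> real ^ 'u ^ 'x \<Rightarrow> real ^ 'x ^ 'u \<Rightarrow> nat \<Rightarrow> real
      \<Rightarrow> (nat \<Rightarrow> (real ^ 'x) \<times> (real ^ 'u) \<Rightarrow> real) \<Rightarrow> (nat \<Rightarrow> real ^ 'x)
      \<Rightarrow> (nat \<Rightarrow> real ^ ('x::finite)) \<Rightarrow> (nat \<Rightarrow> real ^ ('u::finite)) \<Rightarrow> real" where
  "regret A B K0 T R c w x u =
     (\<Sum>t=1..T. c t (x t, u t)) -
     (INF \<Phi>\<in>response_ball A B K0 R. \<Sum>t=1..T. c t (traj w \<Phi> t))"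

definition regular_cost :: "real \<Rightarrow> real \<Rightarrow> ('a::euclidean_space \<Rightarrow> real) \<Rightarrow> bool" where
  "regular_cost G D f \<longleftrightarrow>
     convex_on UNIV f \<and> (\<forall>y\<in>cball 0 D. \<exists>g. GDERIV f y :> g \<and> norm g \<le> G * D)"


subsection \<open>Tuples of blocks and the mirror map\<close>

text \<open>An \<open>H\<close>-tuple \<open>(Q 1, \<dots>, Q H)\<close> is a function vanishing outside \<open>{1..H}\<close>.\<close>

definition tuples :: "nat \<Rightarrow> (nat \<Rightarrow> 'b::euclidean_space) set" where
  "tuples H = {Q. \<forall>i. i \<notin> {1..H} \<longrightarrow> Q i = 0}"

definition tuple_inner :: "nat \<Rightarrow> (nat \<Rightarrow> 'b::euclidean_space) \<Rightarrow> (nat \<Rightarrow> 'b) \<Rightarrow> real" where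
  "tuple_inner H G Q = (\<Sum>i=1..H. G i \<bullet> Q i)"

definition norm_p2 :: "real \<Rightarrow> nat \<Rightarrow> (nat \<Rightarrow> 'b::euclidean_space) \<Rightarrow> real" where
  "norm_p2 p H Q = (\<Sum>i=1..H. norm (Q i) powr p) powr (1 / p)"

definition p_exp :: "nat \<Rightarrow> real" where
  "p_exp H = 1 + 1 / ln (exp 1 * real H)"

definition a_fac :: "nat \<Rightarrow> real" where
  "a_fac H = real H powr (1 - 1 / p_exp H)"

definition V_space ::
    "real ^ 'x ^ 'x \<Rightarrow> real ^ 'u ^ 'x \<Rightarrow> nat \<Rightarrow> (nat \<Rightarrow> ('x::finite, 'u::finite) block) set" where
  "V_space A B H =
     {Q \<in> tuples H. fst (Q 1) = 0 \<and>
        (\<forall>i. 1 \<le> i \<and> i < H \<longrightarrow> fst (Q (Suc i)) = A ** fst (Q i) + B ** snd (Q i))}"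

definition Q_ball ::
    "real ^ 'x ^ 'x \<Rightarrow> real ^ 'u ^ 'x \<Rightarrow> nat \<Rightarrow> real
      \<Rightarrow> (nat \<Rightarrow> ('x::finite, 'u::finite) block) set" where
  "Q_ball A B H R = {Q \<in> V_space A B H. norm_p2 (p_exp H) H Q \<le> R}"

text \<open>Frechet gradient on the Euclidean space of \<open>H\<close>-tuples, written out because function types
  carry no inner product structure.\<close>

definition has_tuple_gradient ::
    "nat \<Rightarrow> ((nat \<Rightarrow> 'b::euclidean_space) \<Rightarrow> real) \<Rightarrow> (nat \<Rightarrow> 'b) \<Rightarrow> (nat \<Rightarrow> 'b) \<Rightarrow> bool" where
  "has_tuple_gradient H F G Q \<longleftrightarrow>
     G \<in> tuples H \<and>
     (\<forall>e>0. \<exists>d>0. \<forall>Z\<in>tuples H. L2_set (\<lambda>i. norm (Z i)) {1..H} < d \<longrightarrow>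
        \<bar>F (\<lambda>i. Q i + Z i) - F Q - tuple_inner H G Z\<bar> \<le> e * L2_set (\<lambda>i. norm (Z i)) {1..H})"

definition tuple_gradient ::
    "nat \<Rightarrow> ((nat \<Rightarrow> 'b::euclidean_space) \<Rightarrow> real) \<Rightarrow> (nat \<Rightarrow> 'b) \<Rightarrow> (nat \<Rightarrow> 'b)" where
  "tuple_gradient H F Q = (THE G. has_tuple_gradient H F G Q)"

definition Omega :: "nat \<Rightarrow> (nat \<Rightarrow> 'b::euclidean_space) \<Rightarrow> real" where
  "Omega H Q = 1 / 2 * (norm_p2 (p_exp H) H Q)\<^sup>2"

text \<open>For \<open>Q, Q'\<close> in the subspace \<^const>\<open>V_space\<close> it makes no difference whether the gradient of
  \<^const>\<open>Omega\<close> is taken in the space of all tuples, as here, or in the subspace.\<close>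

definition bregman :: "nat \<Rightarrow> (nat \<Rightarrow> 'b::euclidean_space) \<Rightarrow> (nat \<Rightarrow> 'b) \<Rightarrow> real" where
  "bregman H Q Q' =
     Omega H Q - Omega H Q' - tuple_inner H (tuple_gradient H (Omega H) Q') (\<lambda>i. Q i - Q' i)"

text \<open>Subgradient of the restriction of \<open>F\<close> to \<open>S\<close>. Only the pairing of \<open>g\<close> with differences of
  elements of \<open>S\<close> matters, so \<open>g\<close> itself may be any tuple.\<close>

definition subgradient_on ::
    "nat \<Rightarrow> (nat \<Rightarrow> 'b::euclidean_space) set \<Rightarrow> ((nat \<Rightarrow> 'b) \<Rightarrow> real)
      \<Rightarrow> (nat \<Rightarrow> 'b) \<Rightarrow> (nat \<Rightarrow> 'b) \<Rightarrow> bool" where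
  "subgradient_on H S F Q g \<longleftrightarrow>
     g \<in> tuples H \<and> Q \<in> S \<and> (\<forall>Q'\<in>S. F Q' \<ge> F Q + tuple_inner H g (\<lambda>i. Q' i - Q i))"


subsection \<open>The algorithm\<close>

definition ybar ::
    "real ^ 'x ^ 'x \<Rightarrow> real ^ 'u ^ 'x \<Rightarrow> real ^ 'x ^ 'u \<Rightarrow> (nat \<Rightarrow> real ^ 'x) \<Rightarrow> nat
      \<Rightarrow> (nat \<Rightarrow> ('x::finite, 'u::finite) block) \<Rightarrow> (real ^ 'x) \<times> (real ^ 'u)" where
  "ybar A B K0 w t Q = traj w (\<lambda>i. baseline A B K0 i + Q i) t"

definition step_size ::
    "real ^ 'x ^ 'x \<Rightarrow> real ^ 'u ^ 'x \<Rightarrow> real ^ ('x::finite) ^ ('u::finite) \<Rightarrow> nat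
      \<Rightarrow> real \<Rightarrow> real \<Rightarrow> real \<Rightarrow> real \<Rightarrow> bool" where
  "step_size A B K0 T L W R \<eta> \<longleftrightarrow>
     (if L * W = 0 then \<eta> > 0
      else \<eta> = R * sqrt (p_exp (T - 1) - 1) /
                 (L * W * a_fac (T - 1) * sqrt (real T * kappa A B K0)))"

text \<open>A realized interaction over \<open>T\<close> rounds with costs \<open>c\<close>, disturbances \<open>w\<close>, states \<open>x\<close>, inputs
  \<open>u\<close>, mirror descent iterates \<open>Q\<close> and subgradients \<open>g\<close>. Whatever adaptive strategy the environment
  follows, the sequences it produces satisfy this predicate, so a pathwise bound is a statement
  about all sequences satisfying it.\<close>

definition algorithm_run ::
    "real ^ 'x ^ 'x \<Rightarrow> real ^ 'u ^ 'x \<Rightarrow> real ^ 'x ^ 'u \<Rightarrow> nat \<Rightarrow> real \<Rightarrow> real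
      \<Rightarrow> (nat \<Rightarrow> (real ^ 'x) \<times> (real ^ 'u) \<Rightarrow> real) \<Rightarrow> (nat \<Rightarrow> real ^ 'x)
      \<Rightarrow> (nat \<Rightarrow> real ^ 'x) \<Rightarrow> (nat \<Rightarrow> real ^ 'u)
      \<Rightarrow> (nat \<Rightarrow> nat \<Rightarrow> ('x::finite, 'u::finite) block)
      \<Rightarrow> (nat \<Rightarrow> nat \<Rightarrow> ('x::finite, 'u::finite) block) \<Rightarrow> bool" where
  "algorithm_run A B K0 T R \<eta> c w x u Q g \<longleftrightarrow>
     x 1 = 0 \<and>
     (\<forall>t\<in>{1..T}. x (Suc t) = A *v x t + B *v u t + w t) \<and>
     (\<forall>t\<in>{1..T}. u t =
        snd (ybar A B K0 w t (Q t)) - K0 *v (x t - fst (ybar A B K0 w t (Q t)))) \<and>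
     Q 1 = (\<lambda>i. 0) \<and>
     (if R = 0 then \<forall>t\<in>{1..T}. Q t = (\<lambda>i. 0)
      else \<forall>t\<in>{1..T}.
        subgradient_on (T - 1) (V_space A B (T - 1)) (\<lambda>Q'. c t (ybar A B K0 w t Q')) (Q t) (g t) \<and>
        is_arg_min (\<lambda>Q'. \<eta> * tuple_inner (T - 1) (g t) Q' + bregman (T - 1) Q' (Q t))
          (\<lambda>Q'. Q' \<in> Q_ball A B (T - 1) R) (Q (Suc t)))"

end

theory Submission
  imports Defs
begin

text \<open>
  The costs paid along the played trajectory differ from the surrogate costs \<open>f\<^sub>t (Q\<^sub>t)\<close> only
  through the tracking error \<open>d\<^sub>t\<close>, which satisfies \<open>d\<^sub>t\<^sub>+\<^sub>1 = F\<^sub>0 d\<^sub>t + \<delta>\<^sub>t\<close> with \<open>\<delta>\<^sub>t\<close> linear in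
  \<open>Q\<^sub>t - Q\<^sub>t\<^sub>+\<^sub>1\<close>; hence it is bounded by \<open>\<Lambda>\<^sub>x\<close> times the largest movement of the iterates. Mirror descent
  controls movement and surrogate regret at once, because \<open>\<Omega>\<close> is \<open>(p - 1)\<close>-strongly convex for the
  norm \<open>\<parallel>\<cdot>\<parallel>\<^sub>p\<^sub>,\<^sub>2\<close>. Strong convexity is obtained from 2-uniform convexity of this norm, which in turn
  follows from \<open>\<parallel>Q\<parallel>\<^sup>2 = min\<^sub>\<nu> \<Sum>\<^sub>i \<parallel>Q\<^sub>i\<parallel>\<^sup>2 \<nu>\<^sub>i\<^sup>-\<^sup>r\<close> over weights with \<open>\<Sum>\<^sub>i \<nu>\<^sub>i \<le> 1\<close>, \<open>r = (2 - p) / p\<close>,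
  and a two-point inequality for each coordinate. In the regular case all points at which
  gradients are needed lie in the ball of radius \<open>D\<^sub>R\<close>.
\<close>

subsection \<open>Uniform convexity of the mixed norm\<close>

text \<open>The response ball is an l1-type ball of blocks. The l1 sum lies between
  \<open>norm_p2\<close> and \<open>a_fac H\<close> times \<open>norm_p2\<close>; the choice of p
  keeps \<open>a_fac H\<close> below e, at the price 1 / (p - 1) = ln (e H) in the modulus of strong
  convexity. This is the origin of e and of the logarithm. With M = L W a and \<alpha> = p - 1, a
  round of mirror descent costs \<eta> M^2 / (2 \<alpha>) besides a telescoping term. The l1
  movement is at most a \<eta> M / \<alpha>, so tracking adds \<xi> \<Lambda> \<eta> M^2 / \<alpha>,
  which explains the factor 1 + 2 \<xi> \<Lambda>; \<eta> balances R^2 / (2 \<eta>) against the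
  total of these errors. For p < 2 the potential may fail to be twice differentiable where a block
  vanishes, so strong convexity is derived from midpoint inequalities and first derivatives only.
  The horizon H = T - 1 retains every block that can act within T rounds, so there is no truncation
  error. The radius \<open>D_R\<close> is computed from the l1 diameter of the feasible ball and not
  from the movement bound, so that L = G D_R is fixed before \<eta>.\<close>

lemma powr_two_point:
  fixes r t :: real
  assumes r: "0 \<le> r" "r \<le> 1" and t: "0 \<le> t" "t \<le> 1"
  shows "(1 + t) powr r + (1 - t) powr r \<le> (1 + r) + (1 - r) * ((1 + t) powr r * (1 - t) powr r)"
proof (cases "t = 1")
  \<comment> \<open>The endpoint is separate because differentiation needs 1 - s > 0. With
    \<open>0 powr r = 0\<close> it reads \<open>2 powr r \<le> 1 + r\<close>, weighted AM-GM for 2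
    and 1.\<close>
  case True
  then show ?thesis
    using Youngs_inequality_0[of r "1 - r" 2 1] r by simp
next
  case False
  define h where "h s = (1 + r) + (1 - r) * ((1 + s) powr r * (1 - s) powr r)
      - (1 + s) powr r - (1 - s) powr r" for s :: real
  \<comment> \<open>Both sides vanish at s = 0. In the derivative of the gap the two powers have
    product at least 1, hence sum at least 2 by AM-GM.\<close>
  have slope: "2 * (s * q) \<le> (1 + s) powr q - (1 - s) powr q"
    if s: "0 \<le> s" "s < 1" and q: "0 \<le> q" "q \<le> 1" for s q :: real
  proof -
    have "(1 + 0) powr q - (1 - 0) powr q - 2 * (0 * q)
        \<le> (1 + s) powr q - (1 - s) powr q - 2 * (s * q)"
    proof (rule DERIV_nonneg_imp_nondecreasing[OF s(1)])
      fix v :: real assume v: "0 \<le> v" "v \<le> s"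
      have pos: "1 + v > 0" "1 - v > 0" using v s by auto
      have "2 \<le> (1 + v) powr (q - 1) + (1 - v) powr (q - 1)"
      proof -
        define a b where "a = (1 + v) powr (q - 1)" and "b = (1 - v) powr (q - 1)"
        have ab: "a > 0" "b > 0" using pos by (auto simp: a_def b_def)
        have "a * b = ((1 + v) * (1 - v)) powr (q - 1)"
          using pos by (simp add: a_def b_def powr_mult)
        also have "\<dots> \<ge> 1"
        proof -
          have "0 < (1 + v) * (1 - v)" using pos by simp
          moreover have "(1 + v) * (1 - v) \<le> 1" by (simp add: algebra_simps)
          ultimately have "((1 + v) * (1 - v)) powr (q - 1) \<ge> 1 powr (q - 1)"
            using powr_mono2'[of "q - 1" "(1 + v) * (1 - v)" 1] q by simp
          then show ?thesis by simp
        qed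
        finally have "1 \<le> a * b" .
        moreover have "4 * (a * b) \<le> (a + b)\<^sup>2"
          using zero_le_power2[of "a - b"] by (simp add: power2_eq_square algebra_simps)
        ultimately have "2\<^sup>2 \<le> (a + b)\<^sup>2" by simp
        then show ?thesis using ab power2_le_imp_le[of 2 "a + b"] by (simp add: a_def b_def)
      qed
      then have "0 \<le> q * ((1 + v) powr (q - 1) + (1 - v) powr (q - 1) - 2)"
        using q by simp
      moreover have "((\<lambda>s. (1 + s) powr q - (1 - s) powr q - 2 * (s * q)) has_real_derivative
          q * ((1 + v) powr (q - 1) + (1 - v) powr (q - 1) - 2)) (at v)"
        using pos by (auto intro!: derivative_eq_intros simp: algebra_simps powr_diff)
      ultimately show "\<exists>y. ((\<lambda>s. (1 + s) powr q - (1 - s) powr q - 2 * (s * q))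
          has_real_derivative y) (at v) \<and> 0 \<le> y" by blast
    qed
    then show ?thesis by simp
  qed
  have "h 0 \<le> h t"
  proof (rule DERIV_nonneg_imp_nondecreasing[OF t(1)])
    fix s :: real assume s: "0 \<le> s" "s \<le> t"
    have pos: "1 + s > 0" "1 - s > 0" using s t False by auto
    define a b where "a = (1 + s) powr (r - 1)" and "b = (1 - s) powr (r - 1)"
    have ab: "a > 0" "b > 0" using pos by (auto simp: a_def b_def)
    have split: "(1 + s) powr r = (1 + s) * a" "(1 - s) powr r = (1 - s) * b"
      using pos by (simp_all add: a_def b_def powr_diff)
    have inv: "(1 + s) powr (1 - r) * a = 1" "(1 - s) powr (1 - r) * b = 1"
      using pos by (simp_all add: a_def b_def flip: powr_add)
    \<comment> \<open>Taking out \<open>a * b\<close> turns the sign of the derivative of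
      \<open>h\<close> into the inequality \<open>slope\<close> for the exponent 1 - r.\<close>
    have eq: "a * b * ((1 + s) powr (1 - r) - (1 - s) powr (1 - r) - 2 * (s * (1 - r)))
        = b - a - 2 * (s * (1 - r)) * (a * b)"
      using inv by algebra
    have "2 * (s * (1 - r)) \<le> (1 + s) powr (1 - r) - (1 - s) powr (1 - r)"
      using slope[of s "1 - r"] s r pos by simp
    then have "0 \<le> a * b * ((1 + s) powr (1 - r) - (1 - s) powr (1 - r) - 2 * (s * (1 - r)))"
      using ab by simp
    then have nonneg: "0 \<le> r * (b - a - 2 * (s * (1 - r)) * (a * b))"
      using r unfolding eq by simp
    have "(h has_real_derivative
        (1 - r) * (r * a * (1 - s) powr r - (1 + s) powr r * (r * b)) - r * a + r * b) (at s)"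
      unfolding h_def a_def b_def using pos
      by (auto intro!: derivative_eq_intros simp: algebra_simps powr_diff diff_divide_distrib)
    moreover have "(1 - r) * (r * a * (1 - s) powr r - (1 + s) powr r * (r * b)) - r * a + r * b
        = r * (b - a - 2 * (s * (1 - r)) * (a * b))"
      unfolding split by (simp add: algebra_simps)
    ultimately show "\<exists>y. (h has_real_derivative y) (at s) \<and> 0 \<le> y" using nonneg by auto
  qed
  then show ?thesis by (simp add: h_def)
qed

lemma powr_two_point_abs:
  fixes r t :: real
  assumes r: "0 \<le> r" "r \<le> 1" and t: "\<bar>t\<bar> \<le> 1"
  shows "(1 + t) powr r + (1 - t) powr r \<le> (1 + r) + (1 - r) * ((1 + t) powr r * (1 - t) powr r)"
proof (cases "0 \<le> t")
  case True
  then show ?thesis using powr_two_point[OF r] t by simp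
next
  case False
  then show ?thesis using powr_two_point[OF r, of "- t"] t by (simp add: algebra_simps)
qed

text \<open>Cauchy-Schwarz reduces the cross term to norms; what remains dominates the square of
  \<open>sqrt a * norm m - sqrt b * norm d\<close>.\<close>

lemma quadratic_form_nonneg:
  fixes m d :: "'a::real_inner"
  assumes "0 \<le> a" "0 \<le> b" "c\<^sup>2 \<le> a * b"
  shows "0 \<le> a * (norm m)\<^sup>2 + b * (norm d)\<^sup>2 + 2 * c * (m \<bullet> d)"
proof -
  have "\<bar>c\<bar> \<le> sqrt a * sqrt b"
    using assms real_le_rsqrt[of "\<bar>c\<bar>" "a * b"] by (simp add: real_sqrt_mult)
  then have "\<bar>c\<bar> * \<bar>m \<bullet> d\<bar> \<le> (sqrt a * sqrt b) * (norm m * norm d)"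
    using Cauchy_Schwarz_ineq2[of m d] assms by (intro mult_mono) auto
  then have "- (c * (m \<bullet> d)) \<le> (sqrt a * norm m) * (sqrt b * norm d)"
    using abs_ge_minus_self[of "c * (m \<bullet> d)"] by (simp add: abs_mult mult_ac)
  moreover have "0 \<le> (sqrt a * norm m - sqrt b * norm d)\<^sup>2" by simp
  ultimately show ?thesis
    using assms by (simp add: power2_diff power_mult_distrib)
qed

text \<open>Uniform convexity for a single block; \<open>lam\<close> and \<open>mu\<close> will be
  the weights of this block in two tuples. For weights proportional to 1 + t and 1 - t the claim is
  a quadratic form in the half-sum and half-difference of x and y. A zero weight makes its term
  vanish, as \<open>0 powr (- r) = 0\<close>, so its vector has to vanish too.\<close>

lemma weighted_parallelogram:
  fixes x y :: "'a::real_inner"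
  assumes r: "0 \<le> r" "r \<le> 1"
    and weights: "0 \<le> lam" "0 \<le> mu" "lam = 0 \<Longrightarrow> x = 0" "mu = 0 \<Longrightarrow> y = 0"
  shows "((lam + mu) / 2) powr (- r) *
      ((norm (x + y))\<^sup>2 / 4 + (1 - r) / (1 + r) * ((norm (x - y))\<^sup>2 / 4))
    \<le> ((norm x)\<^sup>2 * lam powr (- r) + (norm y)\<^sup>2 * mu powr (- r)) / 2"
proof (cases "lam + mu = 0")
  case True
  then show ?thesis using weights by auto
next
  case False
  define nu where "nu = (lam + mu) / 2"
  define t where "t = (lam - mu) / (lam + mu)"
  have nu: "nu > 0" using False weights by (auto simp: nu_def)
  have t: "\<bar>t\<bar> \<le> 1" using False weights by (auto simp: t_def divide_simps abs_if)
  have lam: "lam = nu * (1 + t)" and mu: "mu = nu * (1 - t)"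
    using False by (simp_all add: nu_def t_def field_simps)
  define u v where "u = (1 + t) powr r" and "v = (1 - t) powr r"
  define k where "k = (1 - r) / (1 + r)"
  have k: "1 + k = 2 / (1 + r)" using r by (simp add: k_def field_simps)
  have tp: "u + v \<le> (1 + r) + (1 - r) * (u * v)"
    using powr_two_point_abs[OF r t] by (simp add: u_def v_def)
  have "(1 + k) * (1 + r) = 2" "(1 + k) * (1 - r) = 2 * k"
    using r unfolding k by (simp_all add: k_def field_simps)
  moreover have "(1 + k) * ((1 + r) + (1 - r) * (u * v) - (u + v))
      = (1 + k) * (1 + r) + (1 + k) * (1 - r) * (u * v) - (1 + k) * (u + v)"
    by (simp add: algebra_simps)
  ultimately have k_eq: "2 - (1 + k) * (u + v) + 2 * k * (u * v)
      = (1 + k) * ((1 + r) + (1 - r) * (u * v) - (u + v))"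
    by simp
  \<comment> \<open>The two-point inequality scaled by 1 + k. The same expression reappears, times
    \<open>2 * (u * v)\<close>, as the determinant of the quadratic form.\<close>
  have key: "0 \<le> 2 - (1 + k) * (u + v) + 2 * k * (u * v)"
    unfolding k_eq by (rule mult_nonneg_nonneg) (use k tp r in auto)
  \<comment> \<open>For t = -1 or t = 1 one of u, v is 0 and division by \<open>u * v\<close> is
    impossible; there \<open>key\<close> reduces to
    \<open>(1 + k) * 2 powr r \<le> 2\<close>.\<close>
  consider "lam = 0" | "mu = 0" | "lam > 0" "mu > 0" using weights by linarith
  then have "(norm (x + y))\<^sup>2 / 4 + k * ((norm (x - y))\<^sup>2 / 4)
      \<le> ((norm x)\<^sup>2 * (1 + t) powr (- r) + (norm y)\<^sup>2 * (1 - t) powr (- r)) / 2"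
  proof cases
    case 1
    then have t1: "t = -1" and x: "x = 0" using lam nu weights by auto
    have "(1 + k) * v \<le> 2" using key by (simp add: u_def t1)
    then have "(1 + k) * 2 powr r * (norm y)\<^sup>2 \<le> 2 * (norm y)\<^sup>2"
      by (intro mult_right_mono) (auto simp: v_def t1)
    then show ?thesis
      using x by (simp add: t1 powr_minus_divide divide_simps) (simp add: algebra_simps)
  next
    case 2
    then have t1: "t = 1" and y: "y = 0" using mu nu weights by auto
    have "(1 + k) * u \<le> 2" using key by (simp add: v_def t1)
    then have "(1 + k) * 2 powr r * (norm x)\<^sup>2 \<le> 2 * (norm x)\<^sup>2"
      by (intro mult_right_mono) (auto simp: u_def t1)
    then show ?thesis
      using y by (simp add: t1 powr_minus_divide divide_simps) (simp add: algebra_simps)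
  next
    case 3
    then have pos: "1 + t > 0" "1 - t > 0" using lam mu nu by (auto simp: zero_less_mult_iff)
    then have uv: "u > 0" "v > 0" by (auto simp: u_def v_def)
    have "u * v = ((1 + t) * (1 - t)) powr r" using pos by (simp add: u_def v_def powr_mult)
    also have "\<dots> \<le> 1 powr r"
    proof (rule powr_mono2)
      show "(1 + t) * (1 - t) \<le> 1" by (simp add: algebra_simps)
    qed (use pos r in auto)
    finally have uv1: "u * v \<le> 1" by simp
    have "(2 * (u * v))\<^sup>2 \<le> 4 * (u * v)"
      using mult_right_mono[OF uv1, of "4 * (u * v)"] uv by (simp add: power2_eq_square)
    also have "\<dots> \<le> (u + v)\<^sup>2"
      using zero_le_power2[of "u - v"] by (simp add: power2_eq_square algebra_simps)
    finally have c1: "0 \<le> u + v - 2 * (u * v)"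
      using uv power2_le_imp_le[of "2 * (u * v)" "u + v"] by simp
    have "k \<le> 1" using r by (simp add: k_def)
    then have "k * (u * v) \<le> u * v" using uv by simp
    then have c2: "0 \<le> u + v - 2 * k * (u * v)" using c1 by simp
    have "(u + v - 2 * (u * v)) * (u + v - 2 * k * (u * v)) - (v - u)\<^sup>2
        = 2 * (u * v) * (2 - (1 + k) * (u + v) + 2 * k * (u * v))"
      by (simp add: power2_eq_square algebra_simps)
    also have "\<dots> \<ge> 0" using key uv by simp
    finally have c3: "(v - u)\<^sup>2 \<le> (u + v - 2 * (u * v)) * (u + v - 2 * k * (u * v))" by simp
    define m d where "m = (1 / 2) *\<^sub>R (x + y)" and "d = (1 / 2) *\<^sub>R (x - y)"
    have xy: "x = m + d" "y = m - d"
      by (simp_all add: m_def d_def flip: scaleR_add_right scaleR_diff_right)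
    have nm: "(norm (x + y))\<^sup>2 / 4 = (norm m)\<^sup>2" "(norm (x - y))\<^sup>2 / 4 = (norm d)\<^sup>2"
      by (simp_all add: m_def d_def power_mult_distrib power2_eq_square)
    have nx: "(norm x)\<^sup>2 = (norm m)\<^sup>2 + 2 * (m \<bullet> d) + (norm d)\<^sup>2"
      "(norm y)\<^sup>2 = (norm m)\<^sup>2 - 2 * (m \<bullet> d) + (norm d)\<^sup>2"
      unfolding xy by (simp_all add: power2_norm_eq_inner inner_simps inner_commute)
    have "2 * (u * v) * ((norm m)\<^sup>2 + k * (norm d)\<^sup>2) \<le> v * (norm x)\<^sup>2 + u * (norm y)\<^sup>2"
      using quadratic_form_nonneg[OF c1 c2 c3, of m d] unfolding nx by (simp add: algebra_simps)
    then have "(norm m)\<^sup>2 + k * (norm d)\<^sup>2 \<le> (v * (norm x)\<^sup>2 + u * (norm y)\<^sup>2) / (2 * (u * v))"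
      using uv by (simp add: pos_le_divide_eq mult.commute)
    also have "\<dots> = ((norm x)\<^sup>2 / u + (norm y)\<^sup>2 / v) / 2"
      using uv by (simp add: field_simps)
    finally show ?thesis
      unfolding nm u_def v_def by (simp only: powr_minus divide_inverse)
  qed
  then have "nu powr (- r) * ((norm (x + y))\<^sup>2 / 4 + k * ((norm (x - y))\<^sup>2 / 4))
      \<le> nu powr (- r) * (((norm x)\<^sup>2 * (1 + t) powr (- r) + (norm y)\<^sup>2 * (1 - t) powr (- r)) / 2)"
    by (intro mult_left_mono) auto
  also have "\<dots> = ((norm x)\<^sup>2 * lam powr (- r) + (norm y)\<^sup>2 * mu powr (- r)) / 2"
  proof -
    have "lam powr (- r) = nu powr (- r) * (1 + t) powr (- r)"
      "mu powr (- r) = nu powr (- r) * (1 - t) powr (- r)"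
      unfolding lam mu using nu t by (simp_all only: powr_mult)
    then show ?thesis by (simp add: algebra_simps add_divide_distrib)
  qed
  finally show ?thesis by (simp add: nu_def k_def)
qed

section \<open>The mixed norm and its weighted quadratic bound\<close>

lemma norm_p2_nonneg [simp]: "0 \<le> norm_p2 p H Q"
  by (simp add: norm_p2_def)

lemma norm_p2_powr:
  assumes "p > 0"
  shows "norm_p2 p H Q powr p = (\<Sum>i=1..H. norm (Q i) powr p)"
  using assms by (simp add: norm_p2_def powr_powr sum_nonneg)

lemma norm_p2_le_iff:
  assumes "p > 0" "0 \<le> b"
  shows "norm_p2 p H Q \<le> b \<longleftrightarrow> (\<Sum>i=1..H. norm (Q i) powr p) \<le> b powr p"
  using assms norm_p2_powr[OF assms(1), of H Q] powr_mono2[of p "norm_p2 p H Q" b]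
    powr_less_mono2[of p b "norm_p2 p H Q"]
  by (metis less_eq_real_def norm_p2_nonneg not_less)

lemma norm_p2_zero [simp]: "norm_p2 p H (\<lambda>i. 0) = 0"
  by (simp add: norm_p2_def)

lemma norm_p2_scaleR:
  assumes "p > 0"
  shows "norm_p2 p H (\<lambda>i. a *\<^sub>R Q i) = \<bar>a\<bar> * norm_p2 p H Q"
  using assms
  by (simp add: norm_p2_def powr_mult powr_powr sum_nonneg flip: sum_distrib_left)

lemma norm_p2_minus_commute: "norm_p2 p H (\<lambda>i. Q i - Z i) = norm_p2 p H (\<lambda>i. Z i - Q i)"
  by (simp add: norm_p2_def norm_minus_commute)

lemma norm_p2_eq_0:
  assumes "p > 0" "norm_p2 p H Q = 0" "i \<in> {1..H}"
  shows "Q i = 0"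
proof -
  have "(\<Sum>i=1..H. norm (Q i) powr p) = 0"
    using norm_p2_powr[OF assms(1), of H Q] assms by simp
  then show ?thesis using assms by (subst (asm) sum_nonneg_eq_0_iff) auto
qed

text \<open>Hoelder, carried out termwise. As r p / 2 = 1 - p / 2, the p-th power of a block norm is
  the product of the powers p / 2 of its weighted square and 1 - p / 2 of its weight. Young's
  inequality, normalised by the right-hand side B, sums to \<open>B powr (p / 2)\<close>.\<close>

lemma norm_p2_sq_le_weighted:
  fixes Q :: "nat \<Rightarrow> 'b::euclidean_space"
  assumes p: "0 < p" "p \<le> 2" and r: "r = (2 - p) / p"
    and nu: "\<And>i. i \<in> {1..H} \<Longrightarrow> 0 \<le> nu i" "\<And>i. i \<in> {1..H} \<Longrightarrow> nu i = 0 \<Longrightarrow> Q i = 0"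
      "(\<Sum>i=1..H. nu i) \<le> 1"
  shows "(norm_p2 p H Q)\<^sup>2 \<le> (\<Sum>i=1..H. (norm (Q i))\<^sup>2 * nu i powr (- r))"
proof -
  define B where "B = (\<Sum>i=1..H. (norm (Q i))\<^sup>2 * nu i powr (- r))"
  have B_term: "(norm (Q i))\<^sup>2 * nu i powr (- r) \<le> B" if "i \<in> {1..H}" for i
    unfolding B_def using that by (intro member_le_sum) auto
  have B0: "B \<ge> 0" unfolding B_def by (intro sum_nonneg) auto
  show ?thesis
  proof (cases "B = 0")
    case True
    have "Q i = 0" if i: "i \<in> {1..H}" for i
    proof (rule ccontr)
      assume "Q i \<noteq> 0"
      moreover from this have "nu i \<noteq> 0" using nu(2) i by blast
      ultimately have "0 < (norm (Q i))\<^sup>2 * nu i powr (- r)" by simp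
      then show False using B_term[OF i] True by simp
    qed
    then have "norm_p2 p H Q = 0" by (simp add: norm_p2_def)
    then show ?thesis using B0 by (simp add: B_def)
  next
    case False
    then have B: "B > 0" using B0 by simp
    have "norm (Q i) powr p \<le> B powr (p / 2) *
        (p / 2 * ((norm (Q i))\<^sup>2 * nu i powr (- r) / B) + (1 - p / 2) * nu i)"
      if i: "i \<in> {1..H}" for i
    proof (cases "Q i = 0")
      case True
      then show ?thesis using p nu(1)[OF i] by simp
    next
      case False
      then have pos: "nu i > 0" "norm (Q i) > 0" using nu i by (auto simp: less_le)
      define a where "a = (norm (Q i))\<^sup>2 * nu i powr (- r) / B"
      have a: "a > 0" using pos B by (simp add: a_def)
      have sq: "((norm (Q i))\<^sup>2) powr (p / 2) = norm (Q i) powr p"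
        using pos p by (simp add: powr_powr flip: powr_numeral)
      have exps: "(- r) * (p / 2) + (1 - p / 2) = 0" using p by (simp add: r field_simps)
      have "a powr (p / 2) * nu i powr (1 - p / 2)
          = norm (Q i) powr p * (nu i powr ((- r) * (p / 2)) * nu i powr (1 - p / 2)) / B powr (p / 2)"
        using pos B by (simp add: a_def powr_mult powr_divide powr_powr sq)
      also have "\<dots> = norm (Q i) powr p / B powr (p / 2)"
        unfolding powr_add[symmetric] exps using pos by simp
      finally have "norm (Q i) powr p = B powr (p / 2) * (a powr (p / 2) * nu i powr (1 - p / 2))"
        using B by simp
      also have "\<dots> \<le> B powr (p / 2) * (p / 2 * a + (1 - p / 2) * nu i)"
        using Youngs_inequality_0[of "p / 2" "1 - p / 2" a "nu i"] a pos p
        by (intro mult_left_mono) auto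
      finally show ?thesis by (simp add: a_def)
    qed
    then have "(\<Sum>i=1..H. norm (Q i) powr p) \<le> (\<Sum>i=1..H. B powr (p / 2) *
        (p / 2 * ((norm (Q i))\<^sup>2 * nu i powr (- r) / B) + (1 - p / 2) * nu i))"
      by (rule sum_mono)
    also have "\<dots> = B powr (p / 2) *
        (p / 2 * ((\<Sum>i=1..H. (norm (Q i))\<^sup>2 * nu i powr (- r)) / B) + (1 - p / 2) * (\<Sum>i=1..H. nu i))"
      by (simp only: sum.distrib sum_distrib_left[symmetric] sum_divide_distrib[symmetric])
    also have "\<dots> = B powr (p / 2) * (p / 2 * (B / B) + (1 - p / 2) * (\<Sum>i=1..H. nu i))"
      by (simp only: B_def)
    also have "\<dots> \<le> B powr (p / 2) * (p / 2 + (1 - p / 2) * 1)"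
      using p nu(3) B by (intro mult_left_mono add_mono) (auto intro: mult_left_le)
    finally have "(\<Sum>i=1..H. norm (Q i) powr p) \<le> sqrt B powr p"
      using B by (simp add: powr_half_sqrt[symmetric] powr_powr)
    then have "norm_p2 p H Q \<le> sqrt B"
      using norm_p2_le_iff[of p "sqrt B" H Q] p B by simp
    then have "(norm_p2 p H Q)\<^sup>2 \<le> (sqrt B)\<^sup>2" by (intro power_mono) auto
    then show ?thesis using B by (simp add: B_def)
  qed
qed

text \<open>The weights \<open>\<parallel>X\<^sub>i\<parallel>\<^sup>p / \<parallel>X\<parallel>\<^sup>p\<close> are extremal in the weighted bound above, so that the
  inequality reduces to the scalar one for the averaged weights.\<close>

lemma norm_p2_uniform_convexity:
  fixes X Y :: "nat \<Rightarrow> 'b::euclidean_space"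
  assumes p: "1 \<le> p" "p \<le> 2"
  shows "(norm_p2 p H (\<lambda>i. X i + Y i))\<^sup>2 / 4 + (p - 1) * ((norm_p2 p H (\<lambda>i. X i - Y i))\<^sup>2 / 4)
    \<le> ((norm_p2 p H X)\<^sup>2 + (norm_p2 p H Y)\<^sup>2) / 2"
proof -
  define r where "r = (2 - p) / p"
  have r: "0 \<le> r" "r \<le> 1" using p by (auto simp: r_def field_simps)
  \<comment> \<open>The weight exponent is tied to p so that the constant of the weighted
    parallelogram inequality becomes p - 1.\<close>
  have pr: "(1 - r) / (1 + r) = p - 1" using p by (simp add: r_def field_simps)
  \<comment> \<open>For a null tuple the division by 0 yields zero weights, which remain admissible:
    they sum to at most 1 and vanish only at zero blocks.\<close>
  define wt :: "(nat \<Rightarrow> 'b) \<Rightarrow> nat \<Rightarrow> real"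
    where "wt Z i = norm (Z i) powr p / norm_p2 p H Z powr p" for Z i
  have wt_nonneg: "0 \<le> wt Z i" for Z i by (simp add: wt_def)
  have wt_0: "Z i = 0" if "wt Z i = 0" "i \<in> {1..H}" for Z i
    using that norm_p2_eq_0[of p H Z i] p by (auto simp: wt_def)
  have wt_sum: "(\<Sum>i=1..H. wt Z i) \<le> 1" for Z
    using p by (simp add: wt_def norm_p2_powr flip: sum_divide_distrib)
  have wt_eq: "(\<Sum>i=1..H. (norm (Z i))\<^sup>2 * wt Z i powr (- r)) = (norm_p2 p H Z)\<^sup>2" for Z
  proof (cases "norm_p2 p H Z = 0")
    case True
    then show ?thesis using norm_p2_eq_0[of p H Z] p by simp
  next
    case False
    then have N: "norm_p2 p H Z > 0" by (simp add: less_le)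
    have pr': "p * r = 2 - p" using p by (simp add: r_def)
    have "(norm (Z i))\<^sup>2 * wt Z i powr (- r) = norm_p2 p H Z powr (2 - p) * norm (Z i) powr p" for i
    proof (cases "Z i = 0")
      case False
      then have "(norm (Z i))\<^sup>2 * norm (Z i) powr (- (p * r)) = norm (Z i) powr p"
        unfolding pr' by (simp flip: powr_numeral powr_add)
      moreover have "wt Z i powr (- r) = norm (Z i) powr (- (p * r)) * norm_p2 p H Z powr (p * r)"
        using N False by (simp add: wt_def powr_divide powr_powr powr_minus_divide)
      ultimately show ?thesis by (simp add: pr')
    qed (use p in simp)
    then have "(\<Sum>i=1..H. (norm (Z i))\<^sup>2 * wt Z i powr (- r))
        = norm_p2 p H Z powr (2 - p) * norm_p2 p H Z powr p"
      using p by (simp add: norm_p2_powr sum_distrib_left)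
    then show ?thesis using N by (simp flip: powr_add powr_numeral)
  qed
  \<comment> \<open>The averaged weights serve both the sum and the difference, for which an upper
    bound is enough; equality is used for X and Y, each with its own weights.\<close>
  define nu where "nu i = (wt X i + wt Y i) / 2" for i
  have nu_nonneg: "0 \<le> nu i" for i using wt_nonneg[of X i] wt_nonneg[of Y i] by (simp add: nu_def)
  have nu_0: "X i = 0 \<and> Y i = 0" if "nu i = 0" "i \<in> {1..H}" for i
    using that wt_nonneg[of X i] wt_nonneg[of Y i] wt_0[of X i] wt_0[of Y i] by (auto simp: nu_def)
  have nu_sum: "(\<Sum>i=1..H. nu i) \<le> 1"
    using wt_sum[of X] wt_sum[of Y] by (simp add: nu_def sum.distrib flip: sum_divide_distrib)
  have weighted: "(norm_p2 p H Z)\<^sup>2 \<le> (\<Sum>i=1..H. (norm (Z i))\<^sup>2 * nu i powr (- r))"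
    if "\<And>i. i \<in> {1..H} \<Longrightarrow> nu i = 0 \<Longrightarrow> Z i = 0" for Z :: "nat \<Rightarrow> 'b"
    using p nu_nonneg nu_sum that by (intro norm_p2_sq_le_weighted r_def) auto
  have "(norm_p2 p H (\<lambda>i. X i + Y i))\<^sup>2 / 4 + (p - 1) * ((norm_p2 p H (\<lambda>i. X i - Y i))\<^sup>2 / 4)
      \<le> (\<Sum>i=1..H. (norm (X i + Y i))\<^sup>2 * nu i powr (- r)) / 4
        + (p - 1) * ((\<Sum>i=1..H. (norm (X i - Y i))\<^sup>2 * nu i powr (- r)) / 4)"
    using nu_0 p
    by (intro add_mono mult_left_mono divide_right_mono weighted) auto
  also have "\<dots> = (\<Sum>i=1..H. nu i powr (- r) *
      ((norm (X i + Y i))\<^sup>2 / 4 + (p - 1) * ((norm (X i - Y i))\<^sup>2 / 4)))"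
    by (simp add: sum.distrib sum_distrib_left sum_divide_distrib algebra_simps)
  also have "\<dots> \<le> (\<Sum>i=1..H. ((norm (X i))\<^sup>2 * wt X i powr (- r)
      + (norm (Y i))\<^sup>2 * wt Y i powr (- r)) / 2)"
    unfolding nu_def using r wt_nonneg wt_0
    by (intro sum_mono weighted_parallelogram[of r, unfolded pr]) auto
  also have "\<dots> = ((norm_p2 p H X)\<^sup>2 + (norm_p2 p H Y)\<^sup>2) / 2"
    using wt_eq[of X] wt_eq[of Y] by (simp add: sum.distrib flip: sum_divide_distrib)
  finally show ?thesis .
qed

section \<open>The exponent p and comparison with the l1 sum\<close>

lemma p_exp_bounds:
  assumes "H \<ge> 1"
  shows "1 < p_exp H" "p_exp H \<le> 2" and "p_exp H - 1 = 1 / ln (exp 1 * real H)"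
proof -
  have "ln (exp 1 * real H) = 1 + ln (real H)" using assms by (simp add: ln_mult)
  moreover have "ln (real H) \<ge> 0" using assms by simp
  ultimately have "ln (exp 1 * real H) \<ge> 1" by simp
  then show "1 < p_exp H" "p_exp H \<le> 2" by (simp_all add: p_exp_def)
  show "p_exp H - 1 = 1 / ln (exp 1 * real H)" by (simp add: p_exp_def)
qed

text \<open>Hoelder again, by Young's inequality in each block against the uniform weight 1 /
  H.\<close>

lemma sum_norm_le_norm_p2:
  assumes p: "p \<ge> 1" and H: "H \<ge> 1"
  shows "(\<Sum>i=1..H. norm (Q i)) \<le> real H powr (1 - 1 / p) * norm_p2 p H Q"
proof (cases "norm_p2 p H Q = 0")
  case True
  then show ?thesis using norm_p2_eq_0[of p H Q] p by simp
next
  case False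
  define N where "N = norm_p2 p H Q"
  have N: "N > 0" using False by (simp add: N_def less_le)
  have S: "(\<Sum>i=1..H. norm (Q i) powr p) = N powr p"
    using norm_p2_powr[of p H Q] p by (simp add: N_def)
  define h where "h = real H powr (1 - 1 / p)"
  have h: "h > 0" using H by (simp add: h_def)
  have "norm (Q i) \<le> h * N * (1 / p * (norm (Q i) powr p / N powr p) + (1 - 1 / p) * (1 / real H))"
    (is "_ \<le> _ * ?m") for i
  proof (cases "Q i = 0")
    case True
    have "0 \<le> ?m" using p by simp
    then have "0 \<le> h * N * ?m" using h N by (intro mult_nonneg_nonneg) auto
    then show ?thesis using True by simp
  next
    case False
    have "(norm (Q i) powr p / N powr p) powr (1 / p) * (1 / real H) powr (1 - 1 / p) \<le> ?m"
      using False N H p by (intro Youngs_inequality_0) auto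
    also have "(norm (Q i) powr p / N powr p) powr (1 / p) = norm (Q i) / N"
      using N p by (simp add: powr_divide powr_powr)
    also have "(1 / real H) powr (1 - 1 / p) = 1 / h"
      using H by (simp add: h_def powr_divide)
    finally have "h * N * (norm (Q i) / N * (1 / h)) \<le> h * N * ?m"
      using h N by (intro mult_left_mono) auto
    then show ?thesis using h N by simp
  qed
  then have "(\<Sum>i=1..H. norm (Q i)) \<le> (\<Sum>i=1..H. h * N *
      (1 / p * (norm (Q i) powr p / N powr p) + (1 - 1 / p) * (1 / real H)))"
    by (intro sum_mono)
  also have "\<dots> = h * N * (1 / p * ((\<Sum>i=1..H. norm (Q i) powr p) / N powr p)
      + (\<Sum>i=1..H. (1 - 1 / p) * (1 / real H)))"
    by (simp only: sum.distrib sum_distrib_left[symmetric] sum_divide_distrib[symmetric])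
  also have "\<dots> = h * N"
    unfolding S using N H by simp
  finally show ?thesis by (simp add: h_def N_def)
qed

lemma a_fac_pos: "H \<ge> 1 \<Longrightarrow> 0 < a_fac H"
  by (simp add: a_fac_def)

text \<open>The choice of p pays off here: (1 - 1 / p) ln H \<le> (p - 1) ln H = ln H / (1 + ln H)
  \<le> 1.\<close>

lemma a_fac_le_exp_1:
  assumes "H \<ge> 1"
  shows "a_fac H \<le> exp 1"
proof -
  have p: "p_exp H > 1" "p_exp H - 1 = 1 / ln (exp 1 * real H)"
    using p_exp_bounds[OF assms] by auto
  have l: "ln (exp 1 * real H) = 1 + ln (real H)" "ln (real H) \<ge> 0"
    using assms by (simp_all add: ln_mult)
  have "(1 - 1 / p_exp H) * ln (real H) = (p_exp H - 1) / p_exp H * ln (real H)"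
    using p(1) by (simp add: diff_divide_distrib)
  also have "\<dots> \<le> (p_exp H - 1) / 1 * ln (real H)"
    using p(1) l by (intro mult_right_mono divide_left_mono) auto
  also have "\<dots> \<le> 1" using l unfolding p(2) l(1) by simp
  finally show ?thesis using assms by (simp add: a_fac_def powr_def)
qed

lemma powr_convex_combination:
  fixes a b s p :: real
  assumes "0 \<le> a" "0 \<le> b" "0 \<le> s" "s \<le> 1" "1 \<le> p"
  shows "((1 - s) * a + s * b) powr p \<le> (1 - s) * a powr p + s * b powr p"
proof -
  have scaled: "(s * b) powr p \<le> s * b powr p" if "0 \<le> b" "0 \<le> s" "s \<le> 1" for s b :: real
  proof -
    have "s powr p \<le> s powr 1" using that assms by (intro powr_mono') auto
    then show ?thesis using that by (simp add: powr_mult mult_right_mono)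
  qed
  show ?thesis
  proof (cases "a = 0 \<or> b = 0")
    case True
    then show ?thesis using scaled[of b s] scaled[of a "1 - s"] assms by auto
  next
    case False
    then show ?thesis
      using convex_onD[OF powr_convex[OF assms(5)], of s a b] assms by simp
  qed
qed

subsection \<open>Gradients on tuples\<close>

lemma tuple_inner_diff_right:
  "tuple_inner H G (\<lambda>i. Q i - Z i) = tuple_inner H G Q - tuple_inner H G Z"
  by (simp add: tuple_inner_def inner_diff_right sum_subtractf)

lemma tuple_inner_diff_left:
  "tuple_inner H (\<lambda>i. F i - G i) Q = tuple_inner H F Q - tuple_inner H G Q"
  by (simp add: tuple_inner_def inner_diff_left sum_subtractf)

lemma tuple_inner_scaleR_left:
  "tuple_inner H (\<lambda>i. a *\<^sub>R G i) Q = a * tuple_inner H G Q"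
  by (simp add: tuple_inner_def sum_distrib_left)

lemma tuple_inner_scaleR_right:
  "tuple_inner H G (\<lambda>i. a *\<^sub>R Q i) = a * tuple_inner H G Q"
  by (simp add: tuple_inner_def sum_distrib_left)

lemma tuple_inner_add_right:
  "tuple_inner H G (\<lambda>i. Q i + Z i) = tuple_inner H G Q + tuple_inner H G Z"
  by (simp add: tuple_inner_def inner_add_right sum.distrib)

lemma tuple_inner_zero_left [simp]: "tuple_inner H (\<lambda>i. 0) Q = 0"
  by (simp add: tuple_inner_def)

lemma tuple_inner_le_L2:
  "\<bar>tuple_inner H G Z\<bar> \<le> L2_set (\<lambda>i. norm (G i)) {1..H} * L2_set (\<lambda>i. norm (Z i)) {1..H}"
proof -
  have "\<bar>tuple_inner H G Z\<bar> \<le> (\<Sum>i=1..H. \<bar>norm (G i)\<bar> * \<bar>norm (Z i)\<bar>)"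
    unfolding tuple_inner_def
    by (rule order_trans[OF sum_abs sum_mono]) (simp add: Cauchy_Schwarz_ineq2)
  also have "\<dots> \<le> L2_set (\<lambda>i. norm (G i)) {1..H} * L2_set (\<lambda>i. norm (Z i)) {1..H}"
    by (rule L2_set_mult_ineq)
  finally show ?thesis .
qed

lemma L2_set_scaleR:
  "L2_set (\<lambda>i. norm (a *\<^sub>R Z i)) S = \<bar>a\<bar> * L2_set (\<lambda>i. norm (Z i)) S"
  by (simp add: L2_set_right_distrib)

lemma sum_norm_le_L2:
  "(\<Sum>i=1..H. norm (Z i)) \<le> real H * L2_set (\<lambda>i. norm (Z i)) {1..H}"
proof -
  have "(\<Sum>i=1..H. norm (Z i)) \<le> (\<Sum>i=1..H. L2_set (\<lambda>i. norm (Z i)) {1..H})"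
    by (intro sum_mono member_le_L2_set) auto
  then show ?thesis by simp
qed

text \<open>Restriction to a ray, the form in which strong convexity and optimality use gradients.
  Dividing by \<open>l + 1\<close> instead of \<open>l\<close> covers Z = 0.\<close>

lemma has_tuple_gradient_directional:
  assumes F: "has_tuple_gradient H F G Q" and Z: "Z \<in> tuples H" and e: "e > 0"
  obtains d where "d > 0"
    "\<And>s. 0 \<le> s \<Longrightarrow> s < d \<Longrightarrow> \<bar>F (\<lambda>i. Q i + s *\<^sub>R Z i) - F Q - s * tuple_inner H G Z\<bar> \<le> e * s"
proof -
  define l where "l = L2_set (\<lambda>i. norm (Z i)) {1..H}"
  have l: "l \<ge> 0" by (simp add: l_def L2_set_nonneg)
  have "e / (l + 1) > 0" using e l by simp
  then obtain d where d: "d > 0" and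
    bound: "\<And>Z. Z \<in> tuples H \<Longrightarrow> L2_set (\<lambda>i. norm (Z i)) {1..H} < d \<Longrightarrow>
      \<bar>F (\<lambda>i. Q i + Z i) - F Q - tuple_inner H G Z\<bar>
        \<le> e / (l + 1) * L2_set (\<lambda>i. norm (Z i)) {1..H}"
    using F unfolding has_tuple_gradient_def by meson
  show thesis
  proof (rule that[of "d / (l + 1)"])
    show "d / (l + 1) > 0" using d l by simp
    fix s :: real assume s: "0 \<le> s" "s < d / (l + 1)"
    have "s * l \<le> s * (l + 1)" using s by (simp add: algebra_simps)
    also have "\<dots> < d" using s l by (simp add: pos_less_divide_eq)
    finally have sl: "s * l < d" .
    have sZ: "(\<lambda>i. s *\<^sub>R Z i) \<in> tuples H" using Z by (simp add: tuples_def)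
    have "\<bar>F (\<lambda>i. Q i + s *\<^sub>R Z i) - F Q - s * tuple_inner H G Z\<bar> \<le> e / (l + 1) * (s * l)"
      using bound[OF sZ] sl s unfolding L2_set_scaleR tuple_inner_scaleR_right by (simp add: l_def)
    also have "\<dots> = e * s * (l / (l + 1))" by simp
    also have "\<dots> \<le> e * s * 1" using e s l by (intro mult_left_mono) auto
    finally show "\<bar>F (\<lambda>i. Q i + s *\<^sub>R Z i) - F Q - s * tuple_inner H G Z\<bar> \<le> e * s" by simp
  qed
qed

text \<open>Gives meaning to the \<open>THE\<close> in \<open>tuple_gradient\<close>. Tested along
  their own difference, two gradients differ by a tuple whose squared length is below every
  \<open>2 * e\<close>.\<close>

lemma has_tuple_gradient_unique:
  assumes F: "has_tuple_gradient H F G Q" and F': "has_tuple_gradient H F G' Q"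
  shows "G = G'"
proof -
  define Z where "Z = (\<lambda>i. G i - G' i)"
  have Z: "Z \<in> tuples H" using F F' by (simp add: has_tuple_gradient_def tuples_def Z_def)
  have "tuple_inner H Z Z \<le> 0 + 2 * e" if e: "e > 0" for e
  proof -
    obtain d1 where d1: "d1 > 0" "\<And>s. 0 \<le> s \<Longrightarrow> s < d1 \<Longrightarrow>
        \<bar>F (\<lambda>i. Q i + s *\<^sub>R Z i) - F Q - s * tuple_inner H G Z\<bar> \<le> e * s"
      using has_tuple_gradient_directional[OF F Z e] by metis
    obtain d2 where d2: "d2 > 0" "\<And>s. 0 \<le> s \<Longrightarrow> s < d2 \<Longrightarrow>
        \<bar>F (\<lambda>i. Q i + s *\<^sub>R Z i) - F Q - s * tuple_inner H G' Z\<bar> \<le> e * s"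
      using has_tuple_gradient_directional[OF F' Z e] by metis
    define s where "s = min d1 d2 / 2"
    have s: "0 < s" "s < d1" "s < d2" using d1 d2 by (auto simp: s_def)
    have "s * tuple_inner H G Z - s * tuple_inner H G' Z \<le> 2 * e * s"
      using d1(2)[of s] d2(2)[of s] s by linarith
    then have "s * tuple_inner H Z Z \<le> s * (2 * e)"
      by (simp add: Z_def tuple_inner_diff_left algebra_simps)
    then show ?thesis using s by simp
  qed
  then have "tuple_inner H Z Z \<le> 0"
    using field_le_epsilon[of "tuple_inner H Z Z" 0] by (metis add_0 field_sum_of_halves half_gt_zero mult_2)
  then have "\<forall>i\<in>{1..H}. Z i \<bullet> Z i = 0"
    unfolding tuple_inner_def
    by (subst sum_nonneg_eq_0_iff[symmetric]) (auto intro!: antisym sum_nonneg)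
  then have "Z i = 0" for i using Z by (cases "i \<in> {1..H}") (auto simp: tuples_def)
  then show ?thesis by (auto simp: Z_def fun_eq_iff)
qed

lemma tuple_gradient_eqI:
  assumes "has_tuple_gradient H F G Q"
  shows "tuple_gradient H F Q = G"
  unfolding tuple_gradient_def using assms has_tuple_gradient_unique by blast

lemma has_tuple_gradient_sum:
  fixes f :: "'b::euclidean_space \<Rightarrow> real"
  assumes f: "\<And>i. i \<in> {1..H} \<Longrightarrow> GDERIV f (Q i) :> G i" and G: "G \<in> tuples H"
  shows "has_tuple_gradient H (\<lambda>Q. \<Sum>i=1..H. f (Q i)) G Q"
  unfolding has_tuple_gradient_def
proof (intro conjI allI impI G)
  fix e :: real assume e: "e > 0"
  \<comment> \<open>Summing the block errors costs a factor H by \<open>sum_norm_le_L2\<close>; the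
    added 1 keeps the quotient sound for H = 0.\<close>
  define e' where "e' = e / (real H + 1)"
  have e': "e' > 0" using e by (simp add: e'_def)
  have "\<exists>d>0. \<forall>z. norm z < d \<longrightarrow> \<bar>f (Q i + z) - f (Q i) - G i \<bullet> z\<bar> \<le> e' * norm z"
    if i: "i \<in> {1..H}" for i
  proof -
    obtain d where "d > 0" and
      d: "\<And>y. norm (y - Q i) < d \<Longrightarrow> norm (f y - f (Q i) - (y - Q i) \<bullet> G i) \<le> e' * norm (y - Q i)"
      using f[OF i] e' unfolding gderiv_def has_derivative_at_alt by blast
    then show ?thesis
      using d[of "Q i + _"] by (intro exI[of _ d]) (auto simp: inner_commute)
  qed
  then obtain d where d: "\<And>i. i \<in> {1..H} \<Longrightarrow> d i > 0"
    "\<And>i z. i \<in> {1..H} \<Longrightarrow> norm z < d i \<Longrightarrow> \<bar>f (Q i + z) - f (Q i) - G i \<bullet> z\<bar> \<le> e' * norm z"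
    by metis
  define d0 where "d0 = Min (insert 1 (d ` {1..H}))"
  have d0: "d0 > 0" using d(1) by (auto simp: d0_def)
  have d0_le: "d0 \<le> d i" if "i \<in> {1..H}" for i
    unfolding d0_def using that by (intro Min_le) auto
  show "\<exists>d>0. \<forall>Z\<in>tuples H. L2_set (\<lambda>i. norm (Z i)) {1..H} < d \<longrightarrow>
      \<bar>(\<Sum>i=1..H. f (Q i + Z i)) - (\<Sum>i=1..H. f (Q i)) - tuple_inner H G Z\<bar>
        \<le> e * L2_set (\<lambda>i. norm (Z i)) {1..H}"
  proof (intro exI[of _ d0] conjI d0 ballI impI)
    fix Z :: "nat \<Rightarrow> 'b"
    assume Z: "L2_set (\<lambda>i. norm (Z i)) {1..H} < d0"
    have "\<bar>f (Q i + Z i) - f (Q i) - G i \<bullet> Z i\<bar> \<le> e' * norm (Z i)" if i: "i \<in> {1..H}" for i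
    proof -
      have "norm (Z i) \<le> L2_set (\<lambda>i. norm (Z i)) {1..H}"
        using i by (intro member_le_L2_set) auto
      then show ?thesis using d(2)[OF i] Z d0_le[OF i] by simp
    qed
    then have "(\<Sum>i=1..H. \<bar>f (Q i + Z i) - f (Q i) - G i \<bullet> Z i\<bar>) \<le> (\<Sum>i=1..H. e' * norm (Z i))"
      by (rule sum_mono)
    also have "\<dots> \<le> e' * (real H * L2_set (\<lambda>i. norm (Z i)) {1..H})"
      unfolding sum_distrib_left[symmetric] using e' sum_norm_le_L2[where Z = Z and H = H]
      by (intro mult_left_mono) auto
    also have "\<dots> = e * (real H / (real H + 1)) * L2_set (\<lambda>i. norm (Z i)) {1..H}"
      by (simp add: e'_def)
    also have "\<dots> \<le> e * 1 * L2_set (\<lambda>i. norm (Z i)) {1..H}"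
      using e by (intro mult_left_mono mult_right_mono L2_set_nonneg) auto
    finally have "(\<Sum>i=1..H. \<bar>f (Q i + Z i) - f (Q i) - G i \<bullet> Z i\<bar>)
        \<le> e * L2_set (\<lambda>i. norm (Z i)) {1..H}" by simp
    moreover have "(\<Sum>i=1..H. f (Q i + Z i)) - (\<Sum>i=1..H. f (Q i)) - tuple_inner H G Z
        = (\<Sum>i=1..H. f (Q i + Z i) - f (Q i) - G i \<bullet> Z i)"
      by (simp add: tuple_inner_def sum_subtractf)
    ultimately show "\<bar>(\<Sum>i=1..H. f (Q i + Z i)) - (\<Sum>i=1..H. f (Q i)) - tuple_inner H G Z\<bar>
        \<le> e * L2_set (\<lambda>i. norm (Z i)) {1..H}"
      using sum_abs[of "\<lambda>i. f (Q i + Z i) - f (Q i) - G i \<bullet> Z i" "{1..H}"] by linarith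
  qed
qed

lemma has_tuple_gradient_compose:
  fixes \<phi> :: "real \<Rightarrow> real"
  assumes F: "has_tuple_gradient H F G Q" and \<phi>: "(\<phi> has_real_derivative a) (at (F Q))"
  shows "has_tuple_gradient H (\<lambda>Q. \<phi> (F Q)) (\<lambda>i. a *\<^sub>R G i) Q"
  unfolding has_tuple_gradient_def
proof (intro conjI allI impI)
  show "(\<lambda>i. a *\<^sub>R G i) \<in> tuples H" using F by (simp add: has_tuple_gradient_def tuples_def)
  fix e :: real assume e: "e > 0"
  define M where "M = L2_set (\<lambda>i. norm (G i)) {1..H} + 1"
  have M: "M > 0" by (simp add: M_def L2_set_nonneg add_nonneg_pos)
  \<comment> \<open>Half of the error goes to linearising \<phi>, where the increment of F is at
    most \<open>l * M\<close>, and half to the gradient of F, magnified by the slope a. Capping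
    \<open>e2\<close> at 1 is what makes the added 1 in \<open>M\<close> sufficient.\<close>
  define e1 where "e1 = e / (2 * M)"
  define e2 where "e2 = min 1 (e / (2 * (\<bar>a\<bar> + 1)))"
  have e1: "e1 > 0" using e M by (simp add: e1_def)
  have e2: "e2 > 0" "e2 \<le> 1" using e by (simp_all add: e2_def)
  have ae2: "\<bar>a\<bar> * e2 \<le> e / 2"
  proof -
    have "\<bar>a\<bar> * e2 \<le> (\<bar>a\<bar> + 1) * (e / (2 * (\<bar>a\<bar> + 1)))"
      using e by (intro mult_mono) (auto simp: e2_def)
    also have "\<dots> = e / 2" by (simp add: divide_simps)
    finally show ?thesis .
  qed
  obtain d1 where d1: "d1 > 0" "\<And>y. \<bar>y - F Q\<bar> < d1 \<Longrightarrow>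
      \<bar>\<phi> y - \<phi> (F Q) - a * (y - F Q)\<bar> \<le> e1 * \<bar>y - F Q\<bar>"
    using \<phi> e1 unfolding has_field_derivative_def has_derivative_at_alt by (metis real_norm_def)
  obtain d2 where d2: "d2 > 0" "\<And>Z. Z \<in> tuples H \<Longrightarrow> L2_set (\<lambda>i. norm (Z i)) {1..H} < d2 \<Longrightarrow>
      \<bar>F (\<lambda>i. Q i + Z i) - F Q - tuple_inner H G Z\<bar> \<le> e2 * L2_set (\<lambda>i. norm (Z i)) {1..H}"
    using F e2(1) unfolding has_tuple_gradient_def by meson
  show "\<exists>d>0. \<forall>Z\<in>tuples H. L2_set (\<lambda>i. norm (Z i)) {1..H} < d \<longrightarrow>
      \<bar>\<phi> (F (\<lambda>i. Q i + Z i)) - \<phi> (F Q) - tuple_inner H (\<lambda>i. a *\<^sub>R G i) Z\<bar>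
        \<le> e * L2_set (\<lambda>i. norm (Z i)) {1..H}"
  proof (intro exI[of _ "min d2 (d1 / M)"] conjI ballI impI)
    show "min d2 (d1 / M) > 0" using d1 d2 M by simp
    fix Z :: "nat \<Rightarrow> 'a"
    assume Z: "Z \<in> tuples H" and small: "L2_set (\<lambda>i. norm (Z i)) {1..H} < min d2 (d1 / M)"
    define l where "l = L2_set (\<lambda>i. norm (Z i)) {1..H}"
    have l: "0 \<le> l" "l < d2" "l * M < d1"
      using small M by (auto simp: l_def L2_set_nonneg pos_less_divide_eq)
    define y where "y = F (\<lambda>i. Q i + Z i)"
    have err: "\<bar>y - F Q - tuple_inner H G Z\<bar> \<le> e2 * l"
      using d2(2)[OF Z] l by (simp add: y_def l_def)
    have "\<bar>tuple_inner H G Z\<bar> \<le> (M - 1) * l"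
      using tuple_inner_le_L2[of H G Z] by (simp add: M_def l_def)
    then have "\<bar>y - F Q\<bar> \<le> (M - 1) * l + e2 * l" using err by linarith
    also have "\<dots> \<le> (M - 1) * l + 1 * l" using e2 l by (intro add_mono mult_right_mono) auto
    finally have yM: "\<bar>y - F Q\<bar> \<le> l * M" by (simp add: algebra_simps)
    have "\<bar>\<phi> y - \<phi> (F Q) - a * (y - F Q)\<bar> \<le> e1 * \<bar>y - F Q\<bar>"
      using d1(2)[of y] yM l by simp
    also have "\<dots> \<le> e1 * (l * M)" using yM e1 by (intro mult_left_mono) auto
    also have "\<dots> = e / 2 * l" using M by (simp add: e1_def)
    finally have p1: "\<bar>\<phi> y - \<phi> (F Q) - a * (y - F Q)\<bar> \<le> e / 2 * l" .
    have "\<bar>a * (y - F Q - tuple_inner H G Z)\<bar> \<le> \<bar>a\<bar> * (e2 * l)"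
      unfolding abs_mult using err by (intro mult_left_mono) auto
    also have "\<dots> \<le> e / 2 * l"
      using mult_right_mono[OF ae2 l(1)] by (simp add: mult.assoc)
    finally have p2: "\<bar>a * (y - F Q) - a * tuple_inner H G Z\<bar> \<le> e / 2 * l"
      by (simp add: right_diff_distrib)
    have "\<bar>\<phi> y - \<phi> (F Q) - a * tuple_inner H G Z\<bar> \<le> e * l" using p1 p2 by linarith
    then show "\<bar>\<phi> (F (\<lambda>i. Q i + Z i)) - \<phi> (F Q) - tuple_inner H (\<lambda>i. a *\<^sub>R G i) Z\<bar>
        \<le> e * L2_set (\<lambda>i. norm (Z i)) {1..H}"
      by (simp add: y_def l_def tuple_inner_scaleR_left)
  qed
qed

text \<open>Iterates may contain zero blocks, where the norm has no gradient. Its p-th power is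
  \<open>norm y powr (p - 1)\<close> times the norm, hence o(norm y) for p > 1; the radius in the
  proof makes the first factor at most e.\<close>

lemma GDERIV_norm_powr:
  fixes q :: "'b::euclidean_space"
  assumes p: "p > 1"
  shows "\<exists>G. GDERIV (\<lambda>q. norm q powr p) q :> G"
proof (cases "q = 0")
  case False
  then have "((\<lambda>s. s powr p) has_real_derivative p * norm q powr (p - 1)) (at (norm q))"
    by (auto intro!: derivative_eq_intros simp: powr_diff)
  then show ?thesis using GDERIV_DERIV_compose[OF GDERIV_norm[OF False]] by blast
next
  case True
  have "GDERIV (\<lambda>q::'b. norm q powr p) 0 :> 0"
    unfolding gderiv_def has_derivative_at_alt
  proof (intro conjI allI impI)
    show "bounded_linear (\<lambda>h::'b. h \<bullet> 0)" by simp
    fix e :: real assume e: "e > 0"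
    show "\<exists>d>0. \<forall>y::'b. norm (y - 0) < d \<longrightarrow>
        norm (norm y powr p - norm (0::'b) powr p - (y - 0) \<bullet> 0) \<le> e * norm (y - 0)"
    proof (intro exI[of _ "e powr (1 / (p - 1))"] conjI allI impI)
      show "e powr (1 / (p - 1)) > 0" using e by simp
      fix y :: 'b assume y: "norm (y - 0) < e powr (1 / (p - 1))"
      have "norm y powr (p - 1) \<le> (e powr (1 / (p - 1))) powr (p - 1)"
        using y p by (intro powr_mono2) auto
      also have "\<dots> = e" using e p by (simp add: powr_powr)
      finally have "norm y powr (p - 1) * norm y \<le> e * norm y" by (intro mult_right_mono) auto
      moreover have "norm y powr p = norm y powr (p - 1) * norm y"
        by (cases "y = 0") (simp_all add: powr_diff)
      ultimately show "norm (norm y powr p - norm (0::'b) powr p - (y - 0) \<bullet> 0) \<le> e * norm (y - 0)"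
        by simp
    qed
  qed
  then show ?thesis using True by blast
qed

text \<open>Each summand is at most \<open>S powr (p - 1)\<close> times its norm, S being the total.
  This places deviations in the response ball inside a mixed-norm ball of the same radius.\<close>

lemma norm_p2_le_sum:
  assumes p: "p \<ge> 1"
  shows "norm_p2 p H Q \<le> (\<Sum>i=1..H. norm (Q i))"
proof -
  define S where "S = (\<Sum>i=1..H. norm (Q i))"
  have S: "S \<ge> 0" by (simp add: S_def sum_nonneg)
  have "norm (Q i) powr p \<le> S powr (p - 1) * norm (Q i)" if i: "i \<in> {1..H}" for i
  proof -
    have "norm (Q i) \<le> S" unfolding S_def using i by (intro member_le_sum) auto
    then have "norm (Q i) powr (p - 1) * norm (Q i) \<le> S powr (p - 1) * norm (Q i)"
      using p by (intro mult_right_mono powr_mono2) auto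
    moreover have "norm (Q i) powr p = norm (Q i) powr (p - 1) * norm (Q i)"
      by (cases "Q i = 0") (simp_all add: powr_diff)
    ultimately show ?thesis by simp
  qed
  then have "(\<Sum>i=1..H. norm (Q i) powr p) \<le> S powr (p - 1) * S"
    unfolding S_def sum_distrib_left by (rule sum_mono)
  also have "\<dots> = S powr p" using S by (cases "S = 0") (simp_all add: powr_diff)
  finally show ?thesis using norm_p2_le_iff[of p S H Q] p S by (simp add: S_def)
qed

subsection \<open>Mirror descent\<close>

text \<open>The chain rule fails here because the p-th root is not differentiable at 0, but
  \<open>Omega\<close> is quadratically small: at most (H l)^2 / 2.\<close>

lemma Omega_gradient_at_null:
  fixes Q :: "nat \<Rightarrow> 'b::euclidean_space"
  assumes H: "H \<ge> 1" and Q: "\<And>i. i \<in> {1..H} \<Longrightarrow> Q i = 0"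
  shows "has_tuple_gradient H (Omega H) (\<lambda>i. 0) Q"
  unfolding has_tuple_gradient_def
proof (intro conjI allI impI)
  show "(\<lambda>i. 0) \<in> tuples H" by (simp add: tuples_def)
  fix e :: real assume e: "e > 0"
  have p: "p_exp H > 1" using p_exp_bounds[OF H] by simp
  show "\<exists>d>0. \<forall>Z\<in>tuples H. L2_set (\<lambda>i. norm (Z i)) {1..H} < d \<longrightarrow>
      \<bar>Omega H (\<lambda>i. Q i + Z i) - Omega H Q - tuple_inner H (\<lambda>i. 0) Z\<bar>
        \<le> e * L2_set (\<lambda>i. norm (Z i)) {1..H}"
  proof (intro exI[of _ "e / (real H)\<^sup>2"] conjI ballI impI)
    show "e / (real H)\<^sup>2 > 0" using e H by simp
    fix Z :: "nat \<Rightarrow> 'b"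
    define l where "l = L2_set (\<lambda>i. norm (Z i)) {1..H}"
    assume "L2_set (\<lambda>i. norm (Z i)) {1..H} < e / (real H)\<^sup>2"
    then have "l \<le> e / (real H)\<^sup>2" by (simp add: l_def)
    then have l: "l \<ge> 0" "l * (real H)\<^sup>2 \<le> e"
      using H by (simp_all add: l_def L2_set_nonneg pos_le_divide_eq)
    have "norm_p2 (p_exp H) H (\<lambda>i. Q i + Z i) = norm_p2 (p_exp H) H Z"
      "norm_p2 (p_exp H) H Q = 0"
      using Q by (auto simp: norm_p2_def)
    then have "\<bar>Omega H (\<lambda>i. Q i + Z i) - Omega H Q\<bar> = (norm_p2 (p_exp H) H Z)\<^sup>2 / 2"
      by (simp add: Omega_def)
    also have "\<dots> \<le> (real H * l)\<^sup>2 / 2"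
      using norm_p2_le_sum[where p = "p_exp H" and H = H and Q = Z]
        sum_norm_le_L2[where H = H and Z = Z] p
      by (intro divide_right_mono power_mono) (auto simp: l_def)
    also have "\<dots> = (l * (real H)\<^sup>2) * l / 2" by (simp add: power2_eq_square)
    also have "\<dots> \<le> e * l / 2" using l by (intro divide_right_mono mult_right_mono) auto
    also have "\<dots> \<le> e * l" using e l by simp
    finally show "\<bar>Omega H (\<lambda>i. Q i + Z i) - Omega H Q - tuple_inner H (\<lambda>i. 0) Z\<bar>
        \<le> e * L2_set (\<lambda>i. norm (Z i)) {1..H}" by (simp add: l_def)
  qed
qed

text \<open>Together with uniqueness, ensures that the gradient inside \<open>bregman\<close> is a
  genuine one at every iterate.\<close>

lemma Omega_differentiable:
  fixes Q :: "nat \<Rightarrow> 'b::euclidean_space"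
  assumes H: "H \<ge> 1"
  shows "\<exists>G. has_tuple_gradient H (Omega H) G Q"
proof -
  define p where "p = p_exp H"
  have p: "p > 1" using p_exp_bounds[OF H] by (simp add: p_def)
  define S where "S Q = (\<Sum>i=1..H. norm (Q i) powr p)" for Q :: "nat \<Rightarrow> 'b"
  show ?thesis
  proof (cases "S Q = 0")
    case True
    then have "norm_p2 p H Q = 0" by (simp add: norm_p2_def S_def)
    then show ?thesis
      using Omega_gradient_at_null[OF H, of Q] norm_p2_eq_0[of p H Q] p by auto
  next
    case False
    have "S Q \<ge> 0" by (simp add: S_def sum_nonneg)
    then have SQ: "S Q > 0" using False by simp
    have "\<forall>i. \<exists>G. GDERIV (\<lambda>q. norm q powr p) (Q i) :> G"
      using GDERIV_norm_powr[OF p] by blast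
    from choice[OF this] obtain G where G: "\<forall>i. GDERIV (\<lambda>q. norm q powr p) (Q i) :> G i"
      by blast
    define G' where "G' i = (if i \<in> {1..H} then G i else 0)" for i
    have "has_tuple_gradient H S G' Q"
      unfolding S_def by (rule has_tuple_gradient_sum) (use G in \<open>auto simp: G'_def tuples_def\<close>)
    moreover have "((\<lambda>s. 1 / 2 * (s powr (1 / p))\<^sup>2) has_real_derivative
        S Q powr (1 / p) * (1 / p * S Q powr (1 / p - 1))) (at (S Q))"
      using SQ by (auto intro!: derivative_eq_intros simp: powr_diff)
    ultimately have "\<exists>G. has_tuple_gradient H (\<lambda>Q. 1 / 2 * (S Q powr (1 / p))\<^sup>2) G Q"
      using has_tuple_gradient_compose by blast
    moreover have "(\<lambda>Q. 1 / 2 * (S Q powr (1 / p))\<^sup>2) = Omega H"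
      by (simp add: Omega_def norm_p2_def S_def p_def fun_eq_iff)
    ultimately show ?thesis by simp
  qed
qed

lemma Omega_gradient:
  assumes "H \<ge> 1"
  shows "has_tuple_gradient H (Omega H) (tuple_gradient H (Omega H) Q) Q"
proof -
  obtain G where "has_tuple_gradient H (Omega H) G Q" using Omega_differentiable[OF assms] by blast
  then show ?thesis by (simp add: tuple_gradient_eqI)
qed

lemma tuple_gradient_Omega_zero:
  assumes "H \<ge> 1"
  shows "tuple_gradient H (Omega H) (\<lambda>i. 0) = (\<lambda>i. 0)"
  by (rule tuple_gradient_eqI[OF Omega_gradient_at_null[OF assms]]) simp

lemma bregman_zero:
  assumes "H \<ge> 1"
  shows "bregman H Q (\<lambda>i. 0) = (norm_p2 (p_exp H) H Q)\<^sup>2 / 2"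
  by (simp add: bregman_def tuple_gradient_Omega_zero[OF assms] Omega_def)

text \<open>Halving the segment repeatedly turns the midpoint inequality of uniform convexity into a bound
  on the Bregman divergence; the contributions of the halvings form a geometric series.\<close>

lemma bregman_strongly_convex:
  fixes Q U :: "nat \<Rightarrow> 'b::euclidean_space"
  assumes H: "H \<ge> 1" and tuples: "Q \<in> tuples H" "U \<in> tuples H"
  shows "(p_exp H - 1) / 2 * (norm_p2 (p_exp H) H (\<lambda>i. U i - Q i))\<^sup>2 \<le> bregman H U Q"
proof -
  define \<alpha> where "\<alpha> = p_exp H - 1"
  define Z where "Z = (\<lambda>i. U i - Q i)"
  define N where "N = norm_p2 (p_exp H) H Z"
  define \<theta> where "\<theta> = tuple_gradient H (Omega H) Q"
  define D where "D s = Omega H (\<lambda>i. Q i + s *\<^sub>R Z i) - Omega H Q - s * tuple_inner H \<theta> Z" for s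
  have Z: "Z \<in> tuples H" using tuples by (simp add: tuples_def Z_def)
  have p: "1 < p_exp H" "p_exp H \<le> 2" using p_exp_bounds[OF H] by auto
  have D1: "D 1 = bregman H U Q" by (simp add: D_def bregman_def Z_def \<theta>_def)
  \<comment> \<open>Uniform convexity for the endpoints Q and Q + s Z, whose half-sum is the
    midpoint; the linear terms of \<open>D\<close> cancel.\<close>
  have halve: "2 * D (s / 2) + \<alpha> * s\<^sup>2 * N\<^sup>2 / 4 \<le> D s" for s
  proof -
    have "(\<lambda>i. Q i + (Q i + s *\<^sub>R Z i)) = (\<lambda>i. 2 *\<^sub>R (Q i + (s / 2) *\<^sub>R Z i))"
      by (simp add: scaleR_add_right scaleR_2 add.assoc)
    then have sum: "norm_p2 (p_exp H) H (\<lambda>i. Q i + (Q i + s *\<^sub>R Z i))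
        = 2 * norm_p2 (p_exp H) H (\<lambda>i. Q i + (s / 2) *\<^sub>R Z i)"
      using norm_p2_scaleR[of "p_exp H" H 2] p by simp
    have diff: "norm_p2 (p_exp H) H (\<lambda>i. Q i - (Q i + s *\<^sub>R Z i)) = \<bar>s\<bar> * N"
      using norm_p2_scaleR[of "p_exp H" H "- s" Z] p by (simp add: N_def)
    have "2 * Omega H (\<lambda>i. Q i + (s / 2) *\<^sub>R Z i) + \<alpha> * s\<^sup>2 * N\<^sup>2 / 4
        \<le> Omega H Q + Omega H (\<lambda>i. Q i + s *\<^sub>R Z i)"
    proof -
      have sq: "(2 * a)\<^sup>2 / 4 = a\<^sup>2" "(\<bar>s\<bar> * N)\<^sup>2 = s\<^sup>2 * N\<^sup>2" for a :: real
        by (simp_all add: power_mult_distrib)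
      have halves: "2 * (1 / 2 * a) + c / 4 \<le> 1 / 2 * b + 1 / 2 * d" if "a + c / 4 \<le> (b + d) / 2"
        for a b c d :: real
        using that by simp
      show ?thesis
        using norm_p2_uniform_convexity[OF less_imp_le[OF p(1)] p(2), of H Q "\<lambda>i. Q i + s *\<^sub>R Z i"]
        unfolding sum diff sq Omega_def \<alpha>_def[symmetric] mult.assoc times_divide_eq_right
        by (rule halves)
    qed
    then show ?thesis by (simp add: D_def algebra_simps)
  qed
  \<comment> \<open>The halving from 1 / 2^n gains \<alpha> / 2 N^2 (1 / 2^n - 1 / 2^(n+1)), so the
    gains telescope.\<close>
  have iterate: "2 ^ n * D (1 / 2 ^ n) + \<alpha> / 2 * N\<^sup>2 * (1 - 1 / 2 ^ n) \<le> D 1" for n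
  proof (induction n)
    case (Suc n)
    have "2 ^ n * (2 * D (1 / 2 ^ n / 2) + \<alpha> * (1 / 2 ^ n)\<^sup>2 * N\<^sup>2 / 4) \<le> 2 ^ n * D (1 / 2 ^ n)"
      by (intro mult_left_mono halve) auto
    also have "2 ^ n * (2 * D (1 / 2 ^ n / 2) + \<alpha> * (1 / 2 ^ n)\<^sup>2 * N\<^sup>2 / 4)
        = 2 ^ Suc n * D (1 / 2 ^ Suc n) + \<alpha> / 2 * N\<^sup>2 * (1 / 2 ^ n - 1 / 2 ^ Suc n)"
      by (simp add: field_simps power2_eq_square)
    finally show ?case using Suc.IH unfolding right_diff_distrib by linarith
  qed simp
  \<comment> \<open>\<open>2 ^ n * D (1 / 2 ^ n)\<close> tends to 0, since \<open>D\<close> has its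
    tangent term removed. A large n leaves e / 2 for this term and e / 2 for the missing tail of the
    series.\<close>
  have "\<alpha> / 2 * N\<^sup>2 \<le> D 1 + e" if e: "e > 0" for e
  proof -
    have "e / 2 > 0" using e by simp
    then obtain d where d: "d > 0" "\<And>s. 0 \<le> s \<Longrightarrow> s < d \<Longrightarrow> \<bar>D s\<bar> \<le> e / 2 * s"
      using has_tuple_gradient_directional[OF Omega_gradient[OF H] Z] unfolding D_def \<theta>_def by metis
    define d' where "d' = min d (e / (\<alpha> * N\<^sup>2 + 1))"
    have "\<alpha> \<ge> 0" using p by (simp add: \<alpha>_def)
    then have \<alpha>N: "\<alpha> * N\<^sup>2 \<ge> 0" by simp
    have d': "d' > 0" using d e \<alpha>N by (simp add: d'_def)
    obtain n where n: "(1 / 2) ^ n < d'" using real_arch_pow_inv[OF d', of "1 / 2"] by auto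
    have small: "1 / 2 ^ n < d" "1 / 2 ^ n \<le> e / (\<alpha> * N\<^sup>2 + 1)"
      using n by (auto simp: d'_def power_one_over)
    define \<kappa> h where "\<kappa> = \<alpha> / 2 * N\<^sup>2" and "h = (1 / 2 ^ n :: real)"
    have h: "h > 0" "2 ^ n * h = 1" by (simp_all add: h_def)
    have "- (e / 2 * h) \<le> D h" using d(2)[of h] small h by (simp add: h_def)
    then have "2 ^ n * - (e / 2 * h) \<le> 2 ^ n * D h" by (intro mult_left_mono) auto
    also have "2 ^ n * - (e / 2 * h) = - (e / 2) * (2 ^ n * h)" by simp
    finally have lower: "- (e / 2) \<le> 2 ^ n * D h" unfolding h(2) by simp
    have "\<kappa> * h \<le> e / 2"
    proof -
      have "\<alpha> * N\<^sup>2 * h \<le> \<alpha> * N\<^sup>2 * (e / (\<alpha> * N\<^sup>2 + 1))"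
        unfolding h_def using small \<alpha>N by (intro mult_left_mono)
      also have "\<dots> = e * (\<alpha> * N\<^sup>2 / (\<alpha> * N\<^sup>2 + 1))" by simp
      also have "\<dots> \<le> e * 1" using e \<alpha>N by (intro mult_left_mono) auto
      finally show ?thesis by (simp add: \<kappa>_def)
    qed
    moreover have "2 ^ n * D h + (\<kappa> - \<kappa> * h) \<le> D 1"
      using iterate[of n] by (simp add: \<kappa>_def h_def right_diff_distrib)
    ultimately show ?thesis using lower unfolding \<kappa>_def[symmetric] by linarith
  qed
  then have "\<alpha> / 2 * N\<^sup>2 \<le> D 1" by (rule field_le_epsilon)
  then show ?thesis by (simp add: D1 \<alpha>_def N_def Z_def)
qed

text \<open>Moving from the minimiser P slightly towards U cannot decrease the objective. The claim
  is this variational inequality, rewritten by the three-point identity for Bregman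
  divergences.\<close>

lemma mirror_descent_optimality:
  fixes K :: "(nat \<Rightarrow> 'b::euclidean_space) set"
  assumes H: "H \<ge> 1" and K: "K \<subseteq> tuples H"
    and convex: "\<And>X Y s. X \<in> K \<Longrightarrow> Y \<in> K \<Longrightarrow> 0 \<le> s \<Longrightarrow> s \<le> 1 \<Longrightarrow> (\<lambda>i. X i + s *\<^sub>R (Y i - X i)) \<in> K"
    and min: "is_arg_min (\<lambda>Q'. \<eta> * tuple_inner H g Q' + bregman H Q' Q) (\<lambda>Q'. Q' \<in> K) P"
    and U: "U \<in> K"
  shows "\<eta> * tuple_inner H g (\<lambda>i. P i - U i) \<le> bregman H U Q - bregman H U P - bregman H P Q"
proof -
  define Z where "Z = (\<lambda>i. U i - P i)"
  define \<theta> where "\<theta> Q = tuple_gradient H (Omega H) Q" for Q :: "nat \<Rightarrow> 'b"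
  have P: "P \<in> K" using min by (simp add: is_arg_min_def)
  have "P \<in> tuples H" "U \<in> tuples H" using K P U by auto
  then have Z: "Z \<in> tuples H" by (simp add: tuples_def Z_def)
  have "0 \<le> \<eta> * tuple_inner H g Z + (tuple_inner H (\<theta> P) Z - tuple_inner H (\<theta> Q) Z) + e"
    if e: "e > 0" for e
  proof -
    obtain d where d: "d > 0" "\<And>s. 0 \<le> s \<Longrightarrow> s < d \<Longrightarrow>
        \<bar>Omega H (\<lambda>i. P i + s *\<^sub>R Z i) - Omega H P - s * tuple_inner H (\<theta> P) Z\<bar> \<le> e * s"
      using has_tuple_gradient_directional[OF Omega_gradient[OF H] Z e] unfolding \<theta>_def by metis
    define s where "s = min 1 (d / 2)"
    have s: "0 < s" "s \<le> 1" "s < d" using d by (auto simp: s_def)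
    have "(\<lambda>i. P i + s *\<^sub>R Z i) \<in> K" using convex[OF P U] s by (simp add: Z_def)
    then have "\<eta> * tuple_inner H g P + bregman H P Q
        \<le> \<eta> * tuple_inner H g (\<lambda>i. P i + s *\<^sub>R Z i) + bregman H (\<lambda>i. P i + s *\<^sub>R Z i) Q"
      using min by (simp add: is_arg_min_linorder)
    then have "0 \<le> s * (\<eta> * tuple_inner H g Z) + (Omega H (\<lambda>i. P i + s *\<^sub>R Z i) - Omega H P)
        - s * tuple_inner H (\<theta> Q) Z"
      unfolding bregman_def tuple_inner_diff_right tuple_inner_add_right tuple_inner_scaleR_right
      by (simp add: \<theta>_def algebra_simps)
    also have "\<dots> \<le> s * (\<eta> * tuple_inner H g Z) + (s * tuple_inner H (\<theta> P) Z + e * s)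
        - s * tuple_inner H (\<theta> Q) Z"
      using d(2)[of s] s by linarith
    also have "\<dots> = s * (\<eta> * tuple_inner H g Z + (tuple_inner H (\<theta> P) Z - tuple_inner H (\<theta> Q) Z) + e)"
      by (simp add: algebra_simps)
    finally show ?thesis using s by (simp add: zero_le_mult_iff)
  qed
  then have "0 \<le> \<eta> * tuple_inner H g Z + (tuple_inner H (\<theta> P) Z - tuple_inner H (\<theta> Q) Z)"
    by (rule field_le_epsilon)
  then show ?thesis
    unfolding Z_def bregman_def tuple_inner_diff_right by (simp add: \<theta>_def algebra_simps)
qed

text \<open>For the movement, P is compared with Q itself: strong convexity in both directions gives
  \<alpha> n^2 \<le> \<eta> M n. For the regret, Q - U is split at P, and the loss \<eta> M n on the
  first leg is absorbed by the divergence of P from Q. The dual bound is asked on differences inside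
  K only, because g is arbitrary transversally to the subspace.\<close>

lemma mirror_descent_step:
  fixes K :: "(nat \<Rightarrow> 'b::euclidean_space) set"
  assumes H: "H \<ge> 1" and K: "K \<subseteq> tuples H"
    and convex: "\<And>X Y s. X \<in> K \<Longrightarrow> Y \<in> K \<Longrightarrow> 0 \<le> s \<Longrightarrow> s \<le> 1 \<Longrightarrow> (\<lambda>i. X i + s *\<^sub>R (Y i - X i)) \<in> K"
    and min: "is_arg_min (\<lambda>Q'. \<eta> * tuple_inner H g Q' + bregman H Q' Q) (\<lambda>Q'. Q' \<in> K) P"
    and Q: "Q \<in> K" and \<eta>: "\<eta> > 0" and M: "M \<ge> 0"
    and g: "\<And>X Y. X \<in> K \<Longrightarrow> Y \<in> K \<Longrightarrow>
      tuple_inner H g (\<lambda>i. X i - Y i) \<le> M * norm_p2 (p_exp H) H (\<lambda>i. X i - Y i)"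
  shows "norm_p2 (p_exp H) H (\<lambda>i. P i - Q i) \<le> \<eta> * M / (p_exp H - 1)"
    and "U \<in> K \<Longrightarrow> tuple_inner H g (\<lambda>i. Q i - U i)
      \<le> (bregman H U Q - bregman H U P) / \<eta> + \<eta> * M\<^sup>2 / (2 * (p_exp H - 1))"
proof -
  define \<alpha> where "\<alpha> = p_exp H - 1"
  have \<alpha>: "\<alpha> > 0" using p_exp_bounds(1)[OF H] by (simp add: \<alpha>_def)
  define n where "n = norm_p2 (p_exp H) H (\<lambda>i. P i - Q i)"
  have n': "n = norm_p2 (p_exp H) H (\<lambda>i. Q i - P i)" unfolding n_def by (rule norm_p2_minus_commute)
  have n: "n \<ge> 0" by (simp add: n_def)
  have P: "P \<in> K" using min by (simp add: is_arg_min_def)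
  have tuples: "P \<in> tuples H" "Q \<in> tuples H" using K P Q by auto
  have gn: "tuple_inner H g (\<lambda>i. Q i - P i) \<le> M * n" using g[OF Q P] by (simp add: n')
  have D: "\<alpha> / 2 * n\<^sup>2 \<le> bregman H P Q" "\<alpha> / 2 * n\<^sup>2 \<le> bregman H Q P"
    using bregman_strongly_convex[OF H tuples(2,1)] bregman_strongly_convex[OF H tuples]
    unfolding \<alpha>_def n'[symmetric] n_def[symmetric] .
  have QQ: "bregman H Q Q = 0" by (simp add: bregman_def tuple_inner_def)
  have "\<eta> * tuple_inner H g (\<lambda>i. P i - Q i) \<le> bregman H Q Q - bregman H Q P - bregman H P Q"
    by (rule mirror_descent_optimality[OF H K convex min Q])
  then have "\<alpha> / 2 * n\<^sup>2 + \<alpha> / 2 * n\<^sup>2 \<le> \<eta> * tuple_inner H g Q - \<eta> * tuple_inner H g P"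
    using D unfolding QQ tuple_inner_diff_right right_diff_distrib by linarith
  then have "\<alpha> * n\<^sup>2 \<le> \<eta> * tuple_inner H g (\<lambda>i. Q i - P i)"
    by (simp add: tuple_inner_diff_right right_diff_distrib)
  also have "\<dots> \<le> \<eta> * (M * n)" using gn \<eta> by simp
  finally have "n * (n * \<alpha>) \<le> n * (\<eta> * M)" by (simp add: power2_eq_square mult_ac)
  then have "n * \<alpha> \<le> \<eta> * M"
    using n M \<eta> by (cases "n = 0") auto
  then show "norm_p2 (p_exp H) H (\<lambda>i. P i - Q i) \<le> \<eta> * M / (p_exp H - 1)"
    using \<alpha> by (simp add: n_def \<alpha>_def pos_le_divide_eq)
  show "tuple_inner H g (\<lambda>i. Q i - U i)
      \<le> (bregman H U Q - bregman H U P) / \<eta> + \<eta> * M\<^sup>2 / (2 * (p_exp H - 1))" if U: "U \<in> K"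
  proof -
    have "\<eta> * tuple_inner H g (\<lambda>i. P i - U i) \<le> bregman H U Q - bregman H U P - \<alpha> / 2 * n\<^sup>2"
      using mirror_descent_optimality[OF H K convex min U] D by linarith
    moreover have "tuple_inner H g (\<lambda>i. Q i - U i)
        = tuple_inner H g (\<lambda>i. Q i - P i) + tuple_inner H g (\<lambda>i. P i - U i)"
      by (simp add: tuple_inner_diff_right)
    ultimately have "\<eta> * tuple_inner H g (\<lambda>i. Q i - U i)
        \<le> \<eta> * (M * n) + bregman H U Q - bregman H U P - \<alpha> / 2 * n\<^sup>2"
      using mult_left_mono[OF gn less_imp_le[OF \<eta>]] by (simp add: distrib_left)
    moreover have "\<eta> * (M * n) - \<alpha> / 2 * n\<^sup>2 \<le> (\<eta> * M)\<^sup>2 / (2 * \<alpha>)"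
    proof -
      have "0 \<le> (\<eta> * M - \<alpha> * n)\<^sup>2 / (2 * \<alpha>)" using \<alpha> by simp
      also have "\<dots> = (\<eta> * M)\<^sup>2 / (2 * \<alpha>) - \<eta> * (M * n) + \<alpha> / 2 * n\<^sup>2"
        using \<alpha> by (simp add: power2_eq_square field_simps)
      finally show ?thesis by simp
    qed
    ultimately have "\<eta> * tuple_inner H g (\<lambda>i. Q i - U i)
        \<le> bregman H U Q - bregman H U P + (\<eta> * M)\<^sup>2 / (2 * \<alpha>)" by linarith
    also have "\<dots> = \<eta> * ((bregman H U Q - bregman H U P) / \<eta> + \<eta> * M\<^sup>2 / (2 * \<alpha>))"
      using \<eta> \<alpha> by (simp add: power2_eq_square field_simps)
    finally show ?thesis using \<eta> by (simp add: \<alpha>_def)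
  qed
qed

subsection \<open>Responses and tracking\<close>

lemma norm_matrix_vector_mult_le:
  fixes M :: "real ^ 'n::finite ^ 'm::finite"
  shows "norm (M *v v) \<le> norm M * norm v"
proof -
  have "norm (M *v v) = L2_set (\<lambda>i. \<bar>M $ i \<bullet> v\<bar>) UNIV"
    by (simp add: norm_vec_def matrix_vector_mul_component)
  also have "\<dots> \<le> L2_set (\<lambda>i. norm v * norm (M $ i)) UNIV"
    by (intro L2_set_mono) (simp_all add: Cauchy_Schwarz_ineq2 mult.commute[of "norm v"])
  also have "\<dots> = norm v * L2_set (\<lambda>i. norm (M $ i)) UNIV"
    by (rule L2_set_right_distrib[symmetric]) simp
  also have "\<dots> = norm M * norm v" by (simp add: norm_vec_def mult.commute)
  finally show ?thesis .
qed

text \<open>Deliberately crude: it serves to carry summability from operator norms to Frobenius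
  norms, where any constant will do.\<close>

lemma norm_matrix_le_onorm:
  fixes M :: "real ^ 'n::finite ^ 'm::finite"
  shows "norm M \<le> real CARD('m) * real CARD('n) * onorm ((*v) M)"
proof -
  have "norm M \<le> (\<Sum>i\<in>UNIV. norm (M $ i))"
    unfolding norm_vec_def by (rule L2_set_le_sum) simp
  also have "\<dots> \<le> (\<Sum>i\<in>UNIV. \<Sum>j\<in>UNIV. \<bar>M $ i $ j\<bar>)"
    by (intro sum_mono norm_le_l1_cart)
  also have "\<dots> \<le> (\<Sum>i\<in>(UNIV::'m set). \<Sum>j\<in>(UNIV::'n set). onorm ((*v) M))"
    by (intro sum_mono matrix_component_le_onorm)
  finally show ?thesis by (simp add: mult.assoc)
qed

lemma norm_fst_le_norm: "norm (fst z) \<le> norm z"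
  by (cases z) (simp add: norm_fst_le)

lemma block_apply_add: "block_apply (\<Phi> + \<Psi>) v = block_apply \<Phi> v + block_apply \<Psi> v"
  by (simp add: block_apply_def matrix_vector_mult_add_rdistrib)

lemma block_apply_scaleR: "block_apply (a *\<^sub>R \<Phi>) v = a *\<^sub>R block_apply \<Phi> v"
  by (simp add: block_apply_def scaleR_matrix_vector_assoc)

lemma norm_block_apply_le: "norm (block_apply \<Phi> v) \<le> norm \<Phi> * norm v"
proof -
  have "(norm (fst \<Phi> *v v))\<^sup>2 + (norm (snd \<Phi> *v v))\<^sup>2
      \<le> (norm (fst \<Phi>) * norm v)\<^sup>2 + (norm (snd \<Phi>) * norm v)\<^sup>2"
    by (intro add_mono power_mono norm_matrix_vector_mult_le) auto
  then have "norm (block_apply \<Phi> v)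
      \<le> sqrt (((norm (fst \<Phi>))\<^sup>2 + (norm (snd \<Phi>))\<^sup>2) * (norm v)\<^sup>2)"
    by (simp add: block_apply_def norm_prod_def power_mult_distrib distrib_right)
  then show ?thesis by (simp add: norm_prod_def real_sqrt_mult)
qed

lemma bounded_linear_block_apply: "bounded_linear (block_apply \<Phi>)"
  unfolding block_apply_def[abs_def] by (intro bounded_linear_Pair matrix_vector_mul_bounded_linear)

lemma onorm_fst_le_block: "onorm ((*v) (fst \<Phi>)) \<le> onorm (block_apply \<Phi>)"
  and onorm_snd_le_block: "onorm ((*v) (snd \<Phi>)) \<le> onorm (block_apply \<Phi>)"
proof -
  have "norm (fst \<Phi> *v v) \<le> onorm (block_apply \<Phi>) * norm v"
    "norm (snd \<Phi> *v v) \<le> onorm (block_apply \<Phi>) * norm v" for v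
    using onorm[OF bounded_linear_block_apply, of \<Phi> v]
      norm_fst_le[of "fst \<Phi> *v v" "snd \<Phi> *v v"] norm_snd_le[of "snd \<Phi> *v v" "fst \<Phi> *v v"]
    by (auto simp: block_apply_def)
  then show "onorm ((*v) (fst \<Phi>)) \<le> onorm (block_apply \<Phi>)"
    "onorm ((*v) (snd \<Phi>)) \<le> onorm (block_apply \<Phi>)"
    by (auto intro!: onorm_bound onorm_pos_le bounded_linear_block_apply)
qed

lemma norm_block_le_onorm:
  fixes \<Phi> :: "('x::finite, 'u::finite) block"
  shows "norm \<Phi> \<le> (real CARD('x) * real CARD('x) + real CARD('u) * real CARD('x)) *
    onorm (block_apply \<Phi>)"
proof -
  have "norm \<Phi> \<le> norm (fst \<Phi>) + norm (snd \<Phi>)"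
    using norm_Pair_le[of "fst \<Phi>" "snd \<Phi>"] by simp
  also have "\<dots> \<le> real CARD('x) * real CARD('x) * onorm (block_apply \<Phi>)
      + real CARD('u) * real CARD('x) * onorm (block_apply \<Phi>)"
    by (intro add_mono order_trans[OF norm_matrix_le_onorm] mult_left_mono
        onorm_fst_le_block onorm_snd_le_block) auto
  finally show ?thesis by (simp add: distrib_right)
qed

text \<open>Finiteness of \<Lambda> speaks of operator norms, while \<open>S0\<close> adds Frobenius
  norms; this makes \<open>S0\<close> a convergent sum that dominates its partial sums.\<close>

lemma summable_baseline_norm:
  assumes "Lambda_finite A B K0"
  shows "summable (\<lambda>i. norm (baseline A B K0 (Suc i)))"
proof (rule summable_comparison_test')
  show "summable (\<lambda>i. (real CARD('a) * real CARD('a) + real CARD('b) * real CARD('a)) *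
      onorm (block_apply (baseline A B K0 (Suc i))))"
    using assms unfolding Lambda_finite_def by (rule summable_mult)
  show "norm (norm (baseline A B K0 (Suc i)))
      \<le> (real CARD('a) * real CARD('a) + real CARD('b) * real CARD('a)) *
        onorm (block_apply (baseline A B K0 (Suc i)))" for i
    using norm_block_le_onorm[of "baseline A B K0 (Suc i)"] by simp
qed

lemma summable_closed_loop_onorm:
  assumes "Lambda_finite A B K0"
  shows "summable (\<lambda>r. onorm (\<lambda>v. matpow (closed_loop A B K0) r *v v))"
proof (rule summable_comparison_test')
  show "summable (\<lambda>r. onorm (block_apply (baseline A B K0 (Suc r))))"
    using assms by (simp add: Lambda_finite_def)
  show "norm (onorm (\<lambda>v. matpow (closed_loop A B K0) r *v v))
      \<le> onorm (block_apply (baseline A B K0 (Suc r)))" for r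
    using onorm_fst_le_block[of "baseline A B K0 (Suc r)"]
      onorm_pos_le[OF matrix_vector_mul_bounded_linear, of "matpow (closed_loop A B K0) r"]
    by (simp add: baseline_def)
qed

lemma Lambda_x_nonneg:
  assumes "Lambda_finite A B K0"
  shows "0 \<le> Lambda_x A B K0"
  unfolding Lambda_x_def
  by (intro suminf_nonneg summable_closed_loop_onorm assms onorm_pos_le
      matrix_vector_mul_bounded_linear)

lemma chi0_nonneg: "0 \<le> chi0 K0"
  by (simp add: chi0_def)

lemma kappa_ge_1:
  assumes "Lambda_finite A B K0"
  shows "1 \<le> kappa A B K0"
  using Lambda_x_nonneg[OF assms] chi0_nonneg[of K0] by (simp add: kappa_def)

text \<open>A state error d displaces the played pair by d and the feedback -K0 d, so
  \<open>chi0\<close> is the price of the feedback in the stacked norm.\<close>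

lemma norm_tracking_pair_le:
  fixes K0 :: "real ^ 'x::finite ^ 'u::finite"
  shows "norm (v, - (K0 *v v)) \<le> chi0 K0 * norm v"
proof -
  have "(norm (K0 *v v))\<^sup>2 \<le> (onorm ((*v) K0) * norm v)\<^sup>2"
    by (intro power_mono onorm matrix_vector_mul_bounded_linear) auto
  then have "norm (v, - (K0 *v v)) \<le> sqrt ((1 + (onorm ((*v) K0))\<^sup>2) * (norm v)\<^sup>2)"
    by (simp add: norm_prod_def power_mult_distrib algebra_simps)
  then show ?thesis by (simp add: chi0_def real_sqrt_mult)
qed

lemma matrix_diff_rdistrib: "((A::real^'n^'m) - B) ** C = A ** C - B ** C"
  by (simp add: vec_eq_iff matrix_matrix_mult_def left_diff_distrib sum_subtractf)

lemma matrix_diff_ldistrib: "(A::real^'n^'m) ** (B - C) = A ** B - A ** C"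
  by (simp add: vec_eq_iff matrix_matrix_mult_def right_diff_distrib sum_subtractf)

lemma matrix_mult_uminus_right: "(A::real^'n^'m) ** (- B) = - (A ** B)"
  by (simp add: vec_eq_iff matrix_matrix_mult_def sum_negf)

lemma matrix_mult_combination_right:
  "(A::real^'n^'m) ** (X + s *\<^sub>R (Y - Z)) = A ** X + s *\<^sub>R (A ** Y - A ** Z)"
  by (simp add: vec_eq_iff matrix_matrix_mult_def sum.distrib sum_subtractf sum_distrib_left
      algebra_simps)

lemma baseline_response: "response A B (baseline A B K0)"
  unfolding response_def
proof (intro conjI allI impI)
  show "fst (baseline A B K0 1) = mat 1" by (simp add: baseline_def)
  fix i :: nat assume "i \<ge> 1"
  then obtain j where "i = Suc j" by (cases i) auto
  then show "fst (baseline A B K0 (Suc i))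
      = A ** fst (baseline A B K0 i) + B ** snd (baseline A B K0 i)"
    by (simp add: baseline_def closed_loop_def matrix_diff_rdistrib matrix_mul_assoc
        matrix_mult_uminus_right)
qed

section \<open>Disturbance-response trajectories and the tracking error\<close>

lemma traj_add: "traj w (\<lambda>i. \<Phi> i + \<Psi> i) t = traj w \<Phi> t + traj w \<Psi> t"
  by (simp add: traj_def block_apply_add sum.distrib)

lemma traj_scaleR: "traj w (\<lambda>i. a *\<^sub>R \<Phi> i) t = a *\<^sub>R traj w \<Phi> t"
  by (simp add: traj_def block_apply_scaleR scaleR_sum_right)

lemma ybar_diff: "ybar A B K0 w t Q - ybar A B K0 w t Q' = traj w (\<lambda>i. Q i - Q' i) t"
proof -
  have "traj w (\<lambda>i. (Q i - Q' i) + Q' i) t = traj w (\<lambda>i. Q i - Q' i) t + traj w Q' t"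
    by (rule traj_add)
  then show ?thesis by (simp add: ybar_def traj_add)
qed

lemma norm_traj_le:
  assumes w: "\<And>s. s \<in> {1..T} \<Longrightarrow> norm (w s) \<le> W" and t: "t \<in> {1..T}"
  shows "norm (traj w \<Phi> t) \<le> W * (\<Sum>i=1..T - 1. norm (\<Phi> i))"
proof -
  have W: "0 \<le> W" using w[OF t] norm_ge_zero order_trans by blast
  have "norm (traj w \<Phi> t) \<le> (\<Sum>i\<in>{1..<t}. norm (\<Phi> i) * W)"
    unfolding traj_def
  proof (rule sum_norm_le)
    fix i assume i: "i \<in> {1..<t}"
    have "norm (block_apply (\<Phi> i) (w (t - i))) \<le> norm (\<Phi> i) * norm (w (t - i))"
      by (rule norm_block_apply_le)
    also have "\<dots> \<le> norm (\<Phi> i) * W" using i t by (intro mult_left_mono w) auto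
    finally show "norm (block_apply (\<Phi> i) (w (t - i))) \<le> norm (\<Phi> i) * W" .
  qed
  also have "\<dots> \<le> (\<Sum>i=1..T - 1. norm (\<Phi> i) * W)"
    using t W by (intro sum_mono2) auto
  finally show ?thesis by (simp add: sum_distrib_left mult.commute)
qed

text \<open>An index shift applies the block recursion, and the block of index 1 contributes the
  fresh disturbance. The recursion is asked only below t, so a prefix of T - 1 blocks suffices for
  all t < T.\<close>

lemma traj_step:
  assumes t: "t \<ge> 1" and \<Phi>1: "fst (\<Phi> 1) = mat 1"
    and \<Phi>: "\<And>i. 1 \<le> i \<Longrightarrow> i < t \<Longrightarrow> fst (\<Phi> (Suc i)) = A ** fst (\<Phi> i) + B ** snd (\<Phi> i)"
  shows "fst (traj w \<Phi> (Suc t)) = A *v fst (traj w \<Phi> t) + B *v snd (traj w \<Phi> t) + w t"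
proof -
  have "fst (traj w \<Phi> (Suc t)) = (\<Sum>i\<in>{1..<Suc t}. fst (\<Phi> i) *v w (Suc t - i))"
    by (simp add: traj_def block_apply_def fst_sum)
  also have "\<dots> = fst (\<Phi> 1) *v w t + (\<Sum>i\<in>{Suc 1..<Suc t}. fst (\<Phi> i) *v w (Suc t - i))"
    using t by (subst sum.atLeast_Suc_lessThan) auto
  also have "(\<Sum>i\<in>{Suc 1..<Suc t}. fst (\<Phi> i) *v w (Suc t - i))
      = (\<Sum>i\<in>{1..<t}. fst (\<Phi> (Suc i)) *v w (t - i))"
    by (subst sum.shift_bounds_Suc_ivl) simp
  also have "\<dots> = (\<Sum>i\<in>{1..<t}. A *v (fst (\<Phi> i) *v w (t - i)) + B *v (snd (\<Phi> i) *v w (t - i)))"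
    using \<Phi> by (intro sum.cong) (auto simp: matrix_vector_mult_add_rdistrib matrix_vector_mul_assoc)
  also have "\<dots> = A *v fst (traj w \<Phi> t) + B *v snd (traj w \<Phi> t)"
    by (simp add: traj_def block_apply_def fst_sum snd_sum sum.distrib
        linear_sum[OF matrix_vector_mul_linear])
  finally show ?thesis using \<Phi>1 by simp
qed

text \<open>Discrete variation of constants: from a zero start, d is the convolution of \<delta>
  with the powers of F.\<close>

lemma tracking_error_bound:
  fixes d \<delta> :: "nat \<Rightarrow> real ^ 'n::finite"
  assumes d1: "d 1 = 0" and step: "\<And>t. 1 \<le> t \<Longrightarrow> t < T \<Longrightarrow> d (Suc t) = F *v d t + \<delta> t"
    and \<delta>: "\<And>t. 1 \<le> t \<Longrightarrow> t < T \<Longrightarrow> norm (\<delta> t) \<le> b" and b: "0 \<le> b"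
    and F: "summable (\<lambda>r. onorm (\<lambda>v. matpow F r *v v))" and t: "t \<in> {1..T}"
  shows "norm (d t) \<le> (\<Sum>r. onorm (\<lambda>v. matpow F r *v v)) * b"
proof -
  have unroll: "d (Suc n) = (\<Sum>r<n. matpow F r *v \<delta> (n - r))" if "n < T" for n
    using that
  proof (induction n)
    case 0
    then show ?case using d1 by simp
  next
    case (Suc n)
    have "d (Suc (Suc n)) = F *v d (Suc n) + \<delta> (Suc n)" using Suc.prems by (intro step) auto
    also have "F *v d (Suc n) = (\<Sum>r<n. matpow F (Suc r) *v \<delta> (Suc n - Suc r))"
      using Suc by (simp add: linear_sum[OF matrix_vector_mul_linear] matrix_vector_mul_assoc)
    finally show ?case by (simp add: sum.lessThan_Suc_shift add.commute del: sum.lessThan_Suc)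
  qed
  obtain n where n: "t = Suc n" "n < T" using t by (cases t) auto
  have "norm (d t) \<le> (\<Sum>r<n. onorm (\<lambda>v. matpow F r *v v) * b)"
    unfolding n(1) unroll[OF n(2)]
  proof (rule sum_norm_le)
    fix r assume r: "r \<in> {..<n}"
    have "norm (matpow F r *v \<delta> (n - r)) \<le> onorm (\<lambda>v. matpow F r *v v) * norm (\<delta> (n - r))"
      by (rule onorm) simp
    also have "\<dots> \<le> onorm (\<lambda>v. matpow F r *v v) * b"
      using r n by (intro mult_left_mono \<delta> onorm_pos_le) auto
    finally show "norm (matpow F r *v \<delta> (n - r)) \<le> onorm (\<lambda>v. matpow F r *v v) * b" .
  qed
  also have "\<dots> = (\<Sum>r<n. onorm (\<lambda>v. matpow F r *v v)) * b" by (simp add: sum_distrib_right)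
  also have "\<dots> \<le> (\<Sum>r. onorm (\<lambda>v. matpow F r *v v)) * b"
    using b F by (intro mult_right_mono sum_le_suminf onorm_pos_le) auto
  finally show ?thesis .
qed

section \<open>The feasible set of the iterates\<close>

lemma Q_ball_subset: "Q_ball A B H R \<subseteq> V_space A B H" "V_space A B H \<subseteq> tuples H"
  by (auto simp: Q_ball_def V_space_def)

text \<open>The form with a difference covers segments (Z = X) as well as lines through an iterate
  along the difference of two other points.\<close>

lemma V_space_add_scaleR:
  assumes "X \<in> V_space A B H" "Y \<in> V_space A B H" "Z \<in> V_space A B H"
  shows "(\<lambda>i. X i + s *\<^sub>R (Y i - Z i)) \<in> V_space A B H"
  using assms
  by (auto simp: V_space_def tuples_def matrix_mult_combination_right)
    (simp add: algebra_simps)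

text \<open>The ball is cut out by a sublevel set of the sum of \<open>norm (Q i) powr p\<close>, in
  which each term is convex.\<close>

lemma Q_ball_convex:
  assumes X: "X \<in> Q_ball A B H R" and Y: "Y \<in> Q_ball A B H R" and s: "0 \<le> s" "s \<le> 1"
    and H: "H \<ge> 1"
  shows "(\<lambda>i. X i + s *\<^sub>R (Y i - X i)) \<in> Q_ball A B H R"
proof -
  define p where "p = p_exp H"
  have p: "p > 1" using p_exp_bounds[OF H] by (simp add: p_def)
  have XY: "norm_p2 p H X \<le> R" "norm_p2 p H Y \<le> R" using X Y by (simp_all add: Q_ball_def p_def)
  then have R: "0 \<le> R" using norm_p2_nonneg order_trans by blast
  have "norm (X i + s *\<^sub>R (Y i - X i)) powr p \<le> (1 - s) * norm (X i) powr p + s * norm (Y i) powr p"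
    for i
  proof -
    have "X i + s *\<^sub>R (Y i - X i) = (1 - s) *\<^sub>R X i + s *\<^sub>R Y i" by (simp add: algebra_simps)
    then have "norm (X i + s *\<^sub>R (Y i - X i)) \<le> (1 - s) * norm (X i) + s * norm (Y i)"
      using norm_triangle_ineq[of "(1 - s) *\<^sub>R X i" "s *\<^sub>R Y i"] s by simp
    then have "norm (X i + s *\<^sub>R (Y i - X i)) powr p \<le> ((1 - s) * norm (X i) + s * norm (Y i)) powr p"
      using p by (intro powr_mono2) auto
    also have "\<dots> \<le> (1 - s) * norm (X i) powr p + s * norm (Y i) powr p"
      using s p by (intro powr_convex_combination) auto
    finally show ?thesis .
  qed
  then have "(\<Sum>i=1..H. norm (X i + s *\<^sub>R (Y i - X i)) powr p)
      \<le> (\<Sum>i=1..H. (1 - s) * norm (X i) powr p + s * norm (Y i) powr p)"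
    by (intro sum_mono)
  also have "\<dots> = (1 - s) * (\<Sum>i=1..H. norm (X i) powr p) + s * (\<Sum>i=1..H. norm (Y i) powr p)"
    by (simp add: sum.distrib sum_distrib_left)
  also have "\<dots> \<le> (1 - s) * R powr p + s * R powr p"
    using XY norm_p2_le_iff[of p R H] p R s by (intro add_mono mult_left_mono) auto
  finally have "norm_p2 p H (\<lambda>i. X i + s *\<^sub>R (Y i - X i)) \<le> R"
    using norm_p2_le_iff[of p R H "\<lambda>i. X i + s *\<^sub>R (Y i - X i)"] p R
    by (simp add: left_diff_distrib)
  then show ?thesis
    using X Y Q_ball_subset V_space_add_scaleR[of X A B H Y X s] by (auto simp: Q_ball_def p_def)
qed

subsection \<open>Convex costs with bounded slopes\<close>

text \<open>Upper bound on the one-sided directional derivatives; it holds at every point for a Lipschitz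
  cost and on the closed ball, boundary included, for a regular one.\<close>

definition slope_bounded :: "real \<Rightarrow> ('a::real_normed_vector \<Rightarrow> real) \<Rightarrow> 'a \<Rightarrow> bool" where
  "slope_bounded L f y \<longleftrightarrow>
     (\<forall>z. \<forall>e>0. \<exists>s. 0 < s \<and> s \<le> 1 \<and> f (y + s *\<^sub>R z) - f y \<le> s * (L * norm z + e))"

lemma slope_boundedE:
  assumes "slope_bounded L f y" "e > 0"
  obtains s where "0 < s" "s \<le> 1" "f (y + s *\<^sub>R z) - f y \<le> s * (L * norm z + e)"
  using assms unfolding slope_bounded_def by blast

lemma slope_bounded_lipschitz:
  assumes "L-lipschitz_on UNIV f"
  shows "slope_bounded L f y"
  unfolding slope_bounded_def
proof (intro allI impI exI[of _ 1] conjI)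
  fix z :: 'a and e :: real assume e: "e > 0"
  have "dist (f (y + z)) (f y) \<le> L * dist (y + z) y"
    by (rule lipschitz_onD[OF assms]) auto
  then show "f (y + 1 *\<^sub>R z) - f y \<le> 1 * (L * norm z + e)"
    using e by (simp add: dist_norm)
qed auto

lemma slope_bounded_GDERIV:
  assumes f: "GDERIV f y :> g" and g: "norm g \<le> L"
  shows "slope_bounded L f y"
  unfolding slope_bounded_def
proof (intro allI impI)
  fix z :: 'a and e :: real assume e: "e > 0"
  define e' where "e' = e / (norm z + 1)"
  have e': "e' > 0" using e by (simp add: e'_def add_nonneg_pos)
  then obtain d where d: "d > 0"
    "\<And>v. norm (v - y) < d \<Longrightarrow> norm (f v - f y - (v - y) \<bullet> g) \<le> e' * norm (v - y)"
    using f unfolding gderiv_def has_derivative_at_alt by blast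
  define s where "s = min 1 (d / (norm z + 1))"
  have s: "0 < s" "s \<le> 1" using d by (auto simp: s_def add_nonneg_pos)
  have "s * norm z < s * (norm z + 1)" using s by simp
  also have "\<dots> \<le> d / (norm z + 1) * (norm z + 1)" by (intro mult_right_mono) (auto simp: s_def)
  also have "\<dots> = d" using norm_ge_zero[of z] by (simp add: add_nonneg_eq_0_iff)
  finally have "norm (s *\<^sub>R z) < d" using s by simp
  then have "norm (f (y + s *\<^sub>R z) - f y - (s *\<^sub>R z) \<bullet> g) \<le> e' * norm (s *\<^sub>R z)"
    using d(2)[of "y + s *\<^sub>R z", unfolded add_diff_cancel_left'] by blast
  then have "f (y + s *\<^sub>R z) - f y \<le> s * (z \<bullet> g) + s * (e' * norm z)"
    using s by (simp add: mult_ac)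
  also have "\<dots> \<le> s * (L * norm z) + s * e"
  proof (intro add_mono mult_left_mono)
    have "z \<bullet> g \<le> norm z * norm g" by (rule norm_cauchy_schwarz)
    also have "\<dots> \<le> norm z * L" using g by (intro mult_left_mono) auto
    finally show "z \<bullet> g \<le> L * norm z" by (simp add: mult.commute)
    have "e' * norm z \<le> e' * (norm z + 1)" using e' by simp
    also have "\<dots> = e" using norm_ge_zero[of z] by (simp add: e'_def add_nonneg_eq_0_iff)
    finally show "e' * norm z \<le> e" .
  qed (use s in auto)
  finally show "\<exists>s. 0 < s \<and> s \<le> 1 \<and> f (y + s *\<^sub>R z) - f y \<le> s * (L * norm z + e)"
    using s by (auto simp: distrib_left)
qed

text \<open>y lies between z and a point v slightly beyond y as seen from z, so convexity bounds the
  drop towards z by the rise towards v. Slope control enters at y alone; z and v may lie outside the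
  ball of regularity.\<close>

lemma convex_slope_bounded_diff_le:
  assumes convex: "convex_on UNIV f" and slope: "slope_bounded L f y"
  shows "f y - f z \<le> L * norm (y - z)"
proof (rule field_le_epsilon)
  fix e :: real assume e: "e > 0"
  obtain s where s: "0 < s" "s \<le> 1" and le: "f (y + s *\<^sub>R (y - z)) - f y \<le> s * (L * norm (y - z) + e)"
    using slope_boundedE[OF slope e] by blast
  define v where "v = y + s *\<^sub>R (y - z)"
  \<comment> \<open>The weight for which y = (1 - a) v + a z.\<close>
  define a where "a = s / (1 + s)"
  have a: "0 \<le> a" "a \<le> 1" "1 - a = 1 / (1 + s)" using s by (auto simp: a_def field_simps)
  have v: "(1 + s) *\<^sub>R y = v + s *\<^sub>R z" by (simp add: v_def algebra_simps)
  have "y = (1 / (1 + s)) *\<^sub>R ((1 + s) *\<^sub>R y)" using s by simp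
  then have "y = (1 / (1 + s)) *\<^sub>R (v + s *\<^sub>R z)" unfolding v .
  then have "y = (1 - a) *\<^sub>R v + a *\<^sub>R z"
    unfolding a(3) by (simp add: a_def scaleR_add_right)
  then have "f y \<le> (1 - a) * f v + a * f z"
    using convex_onD[OF convex a(1,2), of v z] by simp
  then have "(1 + s) * f y \<le> (1 + s) * ((1 - a) * f v + a * f z)"
    using s by (intro mult_left_mono) auto
  also have "\<dots> = ((1 + s) * (1 - a)) * f v + ((1 + s) * a) * f z"
    by (simp add: algebra_simps)
  also have "\<dots> = f v + s * f z" using s by (simp add: a(3)) (simp add: a_def)
  finally have "s * (f y - f z) \<le> f v - f y" by (simp add: algebra_simps)
  also have "\<dots> \<le> s * (L * norm (y - z) + e)" using le by (simp add: v_def)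
  finally show "f y - f z \<le> L * norm (y - z) + e" using s by simp
qed

text \<open>Dividing the subgradient inequality at Q + s Z by s compares it with the directional
  slope. S will be the linear space \<open>V_space\<close>, which contains the whole line.\<close>

lemma subgradient_le_slope:
  assumes g: "subgradient_on H S F Q g" and slope: "slope_bounded L f y"
    and mem: "\<And>s. (\<lambda>i. Q i + s *\<^sub>R Z i) \<in> S"
    and F: "\<And>s. F (\<lambda>i. Q i + s *\<^sub>R Z i) = f (y + s *\<^sub>R z)"
  shows "tuple_inner H g Z \<le> L * norm z"
proof (rule field_le_epsilon)
  fix e :: real assume e: "e > 0"
  obtain s where s: "0 < s" "s \<le> 1" and le: "f (y + s *\<^sub>R z) - f y \<le> s * (L * norm z + e)"
    using slope_boundedE[OF slope e] by blast
  have "F Q + s * tuple_inner H g Z \<le> F (\<lambda>i. Q i + s *\<^sub>R Z i)"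
    using g mem[of s] by (auto simp: subgradient_on_def tuple_inner_scaleR_right dest!: bspec)
  moreover have "F Q = f y" using F[of 0] by simp
  ultimately have "s * tuple_inner H g Z \<le> s * (L * norm z + e)" using le by (simp add: F)
  then show "tuple_inner H g Z \<le> L * norm z + e" using s by simp
qed

subsection \<open>Regret\<close>

text \<open>Captures what both cost classes share: Lipschitz costs have bounded slope everywhere,
  regular ones on the ball of radius \<open>D_R\<close>.\<close>

locale tracked_descent =
  fixes A :: "real ^ 'x::finite ^ 'x"
    and B :: "real ^ 'u::finite ^ 'x"
    and K0 :: "real ^ 'x ^ 'u"
    and T :: nat
    and R W L \<eta> :: real
    and c :: "nat \<Rightarrow> (real ^ 'x) \<times> (real ^ 'u) \<Rightarrow> real"
    and w x :: "nat \<Rightarrow> real ^ 'x"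
    and u :: "nat \<Rightarrow> real ^ 'u"
    and Q g :: "nat \<Rightarrow> nat \<Rightarrow> ('x, 'u) block"
  assumes T: "T \<ge> 2" and R: "R \<ge> 0"
    and Lambda: "Lambda_finite A B K0"
    and w: "\<And>t. t \<in> {1..T} \<Longrightarrow> norm (w t) \<le> W"
    and step: "step_size A B K0 T L W R \<eta>"
    and run: "algorithm_run A B K0 T R \<eta> c w x u Q g"
    and L: "L \<ge> 0"
    and convex: "\<And>t. t \<in> {1..T} \<Longrightarrow> convex_on UNIV (c t)"
    and slope: "\<And>t y. t \<in> {1..T} \<Longrightarrow> norm y \<le> D_R A B K0 W R \<Longrightarrow> slope_bounded L (c t) y"
begin

abbreviation "H \<equiv> T - 1"
abbreviation "p \<equiv> p_exp H"
abbreviation "a \<equiv> a_fac H"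
abbreviation "\<xi> \<equiv> chi0 K0"
abbreviation "\<Lambda> \<equiv> Lambda_x A B K0"
abbreviation "M \<equiv> L * W * a"
abbreviation "yb \<equiv> ybar A B K0 w"
abbreviation "QB \<equiv> Q_ball A B H R"
abbreviation "N \<equiv> norm_p2 p H"

lemma H: "H \<ge> 1" using T by simp

lemma p: "1 < p" "p \<le> 2" "p - 1 = 1 / ln (exp 1 * real H)"
  by (rule p_exp_bounds[OF H])+

lemma W: "W \<ge> 0"
  using w[of 1] T norm_ge_zero[of "w 1"] by (simp del: norm_ge_zero)

lemma a: "0 < a" "a \<le> exp 1"
  using a_fac_pos[OF H] a_fac_le_exp_1[OF H] by auto

lemma M: "0 \<le> M" using L W a by simp

lemma \<Lambda>: "0 \<le> \<Lambda>" by (rule Lambda_x_nonneg[OF Lambda])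

lemma \<xi>: "0 \<le> \<xi>" by (rule chi0_nonneg)

lemma zero_in_ball: "(\<lambda>i. 0) \<in> QB"
  using R by (simp add: Q_ball_def V_space_def tuples_def)

lemma Q1: "Q 1 = (\<lambda>i. 0)"
  using run by (simp add: algorithm_run_def)

lemma Q_in_ball: "t \<in> {1..T} \<Longrightarrow> Q t \<in> QB"
proof (induction t rule: nat_less_induct)
  case (1 t)
  show ?case
  proof (cases "R = 0 \<or> t = 1")
    case True
    then have "Q t = (\<lambda>i. 0)" using run Q1 1 by (auto simp: algorithm_run_def)
    then show ?thesis using zero_in_ball by simp
  next
    case False
    then obtain s where s: "t = Suc s" "s \<in> {1..T}" using 1 by (cases t) auto
    then show ?thesis using run False by (auto simp: algorithm_run_def is_arg_min_def)
  qed
qed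

lemma ball_in_V: "X \<in> QB \<Longrightarrow> X \<in> V_space A B H"
  by (simp add: Q_ball_def)

lemma ball_sum_le:
  assumes "X \<in> QB"
  shows "(\<Sum>i=1..H. norm (X i)) \<le> a * R"
proof -
  have "(\<Sum>i=1..H. norm (X i)) \<le> a * N X"
    unfolding a_fac_def using p H by (intro sum_norm_le_norm_p2) auto
  also have "\<dots> \<le> a * R" using assms a by (intro mult_left_mono) (auto simp: Q_ball_def)
  finally show ?thesis .
qed

lemma diff_sum_le: "(\<Sum>i=1..H. norm (X i - Y i)) \<le> a * N (\<lambda>i. X i - Y i)"
  unfolding a_fac_def using p H by (intro sum_norm_le_norm_p2) auto

lemma ball_diff_sum_le:
  assumes "X \<in> QB" "Y \<in> QB"
  shows "(\<Sum>i=1..H. norm (X i - Y i)) \<le> 2 * (a * R)"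
proof -
  have "(\<Sum>i=1..H. norm (X i - Y i)) \<le> (\<Sum>i=1..H. norm (X i) + norm (Y i))"
    by (intro sum_mono norm_triangle_ineq4)
  also have "\<dots> \<le> a * R + a * R"
    unfolding sum.distrib using assms by (intro add_mono ball_sum_le)
  finally show ?thesis by (simp only: mult_2)
qed

lemma norm_yb_le:
  assumes t: "t \<in> {1..T}" and X: "X \<in> QB"
  shows "norm (yb t X) \<le> W * (S0 A B K0 + exp 1 * R)"
proof -
  have "norm (yb t X) \<le> norm (traj w (baseline A B K0) t) + norm (traj w X t)"
    unfolding ybar_def traj_add by (rule norm_triangle_ineq)
  also have "\<dots> \<le> W * (\<Sum>i=1..H. norm (baseline A B K0 i)) + W * (\<Sum>i=1..H. norm (X i))"
    using w t by (intro add_mono norm_traj_le) auto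
  also have "\<dots> \<le> W * S0 A B K0 + W * (exp 1 * R)"
  proof (intro add_mono mult_left_mono W)
    have "(\<Sum>i=1..H. norm (baseline A B K0 i)) = (\<Sum>i<H. norm (baseline A B K0 (Suc i)))"
      by (simp add: sum.atLeast1_atMost_eq)
    also have "\<dots> \<le> S0 A B K0"
      unfolding S0_def by (intro sum_le_suminf summable_baseline_norm Lambda) auto
    finally show "(\<Sum>i=1..H. norm (baseline A B K0 i)) \<le> S0 A B K0" .
    show "(\<Sum>i=1..H. norm (X i)) \<le> exp 1 * R"
      using ball_sum_le[OF X] mult_right_mono[OF a(2) R] by linarith
  qed
  finally show ?thesis by (simp add: distrib_left)
qed

text \<open>The first summand bounds the surrogate points, the second the tracking deviation, with 2
  e R standing for the l1 diameter of the feasible ball.\<close>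

lemma D_R_eq: "D_R A B K0 W R = W * (S0 A B K0 + exp 1 * R) + 2 * \<xi> * \<Lambda> * W * (exp 1 * R)"
  by (simp add: D_R_def kappa_def algebra_simps)

lemma yb_slope:
  assumes "t \<in> {1..T}" "X \<in> QB"
  shows "slope_bounded L (c t) (yb t X)"
proof (rule slope[OF assms(1)])
  have "0 \<le> 2 * \<xi> * \<Lambda> * W * (exp 1 * R)" using \<xi> \<Lambda> W R by simp
  then show "norm (yb t X) \<le> D_R A B K0 W R"
    using norm_yb_le[OF assms] unfolding D_R_eq by linarith
qed

section \<open>Tracking deviation and the cost of the played pair\<close>

lemma yb_step:
  assumes t: "1 \<le> t" "t < T" and X: "X \<in> V_space A B H"
  shows "fst (yb (Suc t) X) = A *v fst (yb t X) + B *v snd (yb t X) + w t"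
  unfolding ybar_def
proof (rule traj_step[OF t(1)])
  have base: "fst (baseline A B K0 1) = mat 1" "\<And>i. i \<ge> 1 \<Longrightarrow>
      fst (baseline A B K0 (Suc i)) = A ** fst (baseline A B K0 i) + B ** snd (baseline A B K0 i)"
    using baseline_response[of A B K0] by (auto simp: response_def)
  show "fst (baseline A B K0 1 + X 1) = mat 1" using base(1) X by (simp add: V_space_def)
  show "fst (baseline A B K0 (Suc i) + X (Suc i))
      = A ** fst (baseline A B K0 i + X i) + B ** snd (baseline A B K0 i + X i)"
    if i: "1 \<le> i" "i < t" for i
  proof -
    have "fst (X (Suc i)) = A ** fst (X i) + B ** snd (X i)"
      using X i t by (simp add: V_space_def)
    then show ?thesis using base(2)[OF i(1)] by (simp add: matrix_add_ldistrib)
  qed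
qed

text \<open>Under the old iterate the surrogate state follows the plant dynamics from t to t + 1;
  switching to the new iterate injects \<delta>, and the feedback lets the remaining error evolve by
  the closed loop. \<open>b\<close> stays abstract since it is instantiated both by the diameter of
  the ball and by the mirror descent movement.\<close>

lemma tracking_deviation:
  assumes b: "\<And>t. 1 \<le> t \<Longrightarrow> t < T \<Longrightarrow> (\<Sum>i=1..H. norm (Q t i - Q (Suc t) i)) \<le> b" "0 \<le> b"
    and t: "t \<in> {1..T}"
  shows "norm (x t - fst (yb t (Q t))) \<le> \<Lambda> * (W * b)"
  unfolding Lambda_x_def
proof (rule tracking_error_bound[OF _ _ _ _ summable_closed_loop_onorm[OF Lambda] t])
  define d where "d t = x t - fst (yb t (Q t))" for t
  define \<delta> where "\<delta> t = fst (traj w (\<lambda>i. Q t i - Q (Suc t) i) (Suc t))" for t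
  show "x 1 - fst (yb 1 (Q 1)) = 0"
    using run by (simp add: algorithm_run_def ybar_def traj_def)
  show "x (Suc t) - fst (yb (Suc t) (Q (Suc t)))
      = closed_loop A B K0 *v (x t - fst (yb t (Q t))) + \<delta> t" if t: "1 \<le> t" "t < T" for t
  proof -
    have x: "x (Suc t) = A *v x t + B *v u t + w t" and u: "u t = snd (yb t (Q t)) - K0 *v d t"
      using run t by (auto simp: algorithm_run_def d_def)
    have "\<delta> t = fst (yb (Suc t) (Q t)) - fst (yb (Suc t) (Q (Suc t)))"
      using ybar_diff[of A B K0 w "Suc t" "Q t" "Q (Suc t)"] by (simp only: \<delta>_def fst_diff[symmetric])
    moreover have "fst (yb (Suc t) (Q t)) = A *v fst (yb t (Q t)) + B *v snd (yb t (Q t)) + w t"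
      using t by (intro yb_step ball_in_V Q_in_ball) auto
    moreover have "x t = d t + fst (yb t (Q t))" by (simp add: d_def)
    ultimately have "x (Suc t) - fst (yb (Suc t) (Q (Suc t)))
        = A *v d t - B *v (K0 *v d t) + \<delta> t"
      unfolding x u by (simp add: matrix_vector_right_distrib matrix_vector_mult_diff_distrib)
    then show ?thesis
      by (simp add: closed_loop_def d_def matrix_vector_mult_diff_rdistrib matrix_vector_mul_assoc)
  qed
  show "norm (\<delta> t) \<le> W * b" if t: "1 \<le> t" "t < T" for t
  proof -
    have "norm (\<delta> t) \<le> norm (traj w (\<lambda>i. Q t i - Q (Suc t) i) (Suc t))"
      unfolding \<delta>_def by (rule norm_fst_le_norm)
    also have "\<dots> \<le> W * (\<Sum>i=1..H. norm (Q t i - Q (Suc t) i))"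
      using w t by (intro norm_traj_le) auto
    also have "\<dots> \<le> W * b" using b(1)[OF t] W by (intro mult_left_mono)
    finally show ?thesis .
  qed
  show "0 \<le> W * b" using W b by simp
qed

lemma played_deviation:
  assumes b: "\<And>t. 1 \<le> t \<Longrightarrow> t < T \<Longrightarrow> (\<Sum>i=1..H. norm (Q t i - Q (Suc t) i)) \<le> b" "0 \<le> b"
    and t: "t \<in> {1..T}"
  shows "norm ((x t, u t) - yb t (Q t)) \<le> \<xi> * (\<Lambda> * (W * b))"
proof -
  define d where "d = x t - fst (yb t (Q t))"
  have "u t - snd (yb t (Q t)) = - (K0 *v d)"
    using run t by (simp add: algorithm_run_def d_def)
  then have "(x t, u t) - yb t (Q t) = (d, - (K0 *v d))"
    by (simp add: prod_eq_iff d_def)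
  then have "norm ((x t, u t) - yb t (Q t)) \<le> \<xi> * norm d"
    by (simp add: norm_tracking_pair_le)
  also have "\<dots> \<le> \<xi> * (\<Lambda> * (W * b))"
    unfolding d_def using \<xi> by (intro mult_left_mono tracking_deviation b t)
  finally show ?thesis .
qed

text \<open>The diameter of the ball serves as movement bound, which is valid for every step size
  and consumes exactly the second summand of \<open>D_R\<close>.\<close>

lemma played_slope:
  assumes t: "t \<in> {1..T}"
  shows "slope_bounded L (c t) (x t, u t)"
proof (rule slope[OF t])
  have "norm ((x t, u t) - yb t (Q t)) \<le> \<xi> * (\<Lambda> * (W * (2 * (a * R))))"
    using a R by (intro played_deviation ball_diff_sum_le Q_in_ball t) auto
  also have "\<dots> \<le> \<xi> * (\<Lambda> * (W * (2 * (exp 1 * R))))"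
    using \<xi> \<Lambda> W R a by (intro mult_left_mono mult_right_mono) auto
  finally show "norm (x t, u t) \<le> D_R A B K0 W R"
    using norm_yb_le[OF t Q_in_ball[OF t]] norm_triangle_sub[of "(x t, u t)" "yb t (Q t)"]
    unfolding D_R_eq by (simp add: mult_ac)
qed

lemma played_cost_le:
  assumes b: "\<And>t. 1 \<le> t \<Longrightarrow> t < T \<Longrightarrow> (\<Sum>i=1..H. norm (Q t i - Q (Suc t) i)) \<le> b" "0 \<le> b"
    and t: "t \<in> {1..T}"
  shows "c t (x t, u t) - c t (yb t (Q t)) \<le> \<xi> * \<Lambda> * (L * W * b)"
proof -
  have "c t (x t, u t) - c t (yb t (Q t)) \<le> L * norm ((x t, u t) - yb t (Q t))"
    by (intro convex_slope_bounded_diff_le convex played_slope t)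
  also have "\<dots> \<le> L * (\<xi> * (\<Lambda> * (W * b)))"
    using L by (intro mult_left_mono played_deviation b t)
  finally show ?thesis by (simp add: mult_ac)
qed

section \<open>Linearised costs and comparators\<close>

lemma subgradient:
  assumes "R \<noteq> 0" "t \<in> {1..T}"
  shows "subgradient_on H (V_space A B H) (\<lambda>Q'. c t (yb t Q')) (Q t) (g t)"
    and "is_arg_min (\<lambda>Q'. \<eta> * tuple_inner H (g t) Q' + bregman H Q' (Q t)) (\<lambda>Q'. Q' \<in> QB) (Q (Suc t))"
  using run assms by (auto simp: algorithm_run_def)

text \<open>\<open>M\<close> collects L from the cost, W from the disturbances and a from passing
  between the l1 sum and \<open>norm_p2\<close>.\<close>

lemma subgradient_dual_bound:
  assumes R0: "R \<noteq> 0" and t: "t \<in> {1..T}" and XY: "X \<in> QB" "Y \<in> QB"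
  shows "tuple_inner H (g t) (\<lambda>i. X i - Y i) \<le> M * N (\<lambda>i. X i - Y i)"
proof -
  have "tuple_inner H (g t) (\<lambda>i. X i - Y i) \<le> L * norm (traj w (\<lambda>i. X i - Y i) t)"
  proof (rule subgradient_le_slope[OF subgradient(1)[OF R0 t] yb_slope[OF t Q_in_ball[OF t]]])
    show "(\<lambda>i. Q t i + s *\<^sub>R (X i - Y i)) \<in> V_space A B H" for s
      by (intro V_space_add_scaleR ball_in_V Q_in_ball t XY)
    show "c t (yb t (\<lambda>i. Q t i + s *\<^sub>R (X i - Y i)))
        = c t (yb t (Q t) + s *\<^sub>R traj w (\<lambda>i. X i - Y i) t)" for s
      unfolding ybar_def traj_add traj_scaleR add.assoc ..
  qed
  also have "\<dots> \<le> L * (W * (\<Sum>i=1..H. norm (X i - Y i)))"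
    using L w t by (intro mult_left_mono norm_traj_le) auto
  also have "\<dots> \<le> L * (W * (a * N (\<lambda>i. X i - Y i)))"
    using L W by (intro mult_left_mono diff_sum_le)
  finally show ?thesis by (simp add: mult_ac)
qed

lemma surrogate_cost_le:
  assumes R0: "R \<noteq> 0" and t: "t \<in> {1..T}" and U: "U \<in> QB"
  shows "c t (yb t (Q t)) - c t (yb t U) \<le> tuple_inner H (g t) (\<lambda>i. Q t i - U i)"
proof -
  have "c t (yb t (Q t)) + tuple_inner H (g t) (\<lambda>i. U i - Q t i) \<le> c t (yb t U)"
    using subgradient(1)[OF R0 t] ball_in_V[OF U] unfolding subgradient_on_def by blast
  then show ?thesis by (simp add: tuple_inner_diff_right)
qed

text \<open>U is the deviation from the baseline, cut after H blocks. Later blocks meet no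
  disturbance up to round T, so the trajectories agree exactly; cutting can only lower the l1 sum,
  which dominates \<open>norm_p2\<close>.\<close>

lemma comparator:
  assumes "\<Phi> \<in> response_ball A B K0 R"
  obtains U where "U \<in> QB" "\<And>t. t \<in> {1..T} \<Longrightarrow> traj w \<Phi> t = yb t U"
proof
  define U where "U i = (if i \<in> {1..H} then \<Phi> i - baseline A B K0 i else 0)" for i
  have \<Phi>: "response A B \<Phi>" and summable: "summable (\<lambda>i. norm (\<Phi> (Suc i) - baseline A B K0 (Suc i)))"
    and le: "(\<Sum>i. norm (\<Phi> (Suc i) - baseline A B K0 (Suc i))) \<le> R"
    using assms by (auto simp: response_ball_def)
  have rec: "fst (\<Phi> (Suc i) - baseline A B K0 (Suc i))
      = A ** fst (\<Phi> i - baseline A B K0 i) + B ** snd (\<Phi> i - baseline A B K0 i)" if "1 \<le> i" for i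
    using that \<Phi> baseline_response[of A B K0] by (simp add: response_def matrix_diff_ldistrib)
  have "U \<in> V_space A B H"
    unfolding V_space_def tuples_def
  proof (intro CollectI conjI allI impI)
    show "fst (U 1) = 0"
      using \<Phi> baseline_response[of A B K0] by (simp add: U_def response_def)
    show "fst (U (Suc i)) = A ** fst (U i) + B ** snd (U i)" if "1 \<le> i \<and> i < H" for i
      using that rec[of i] by (simp add: U_def)
  qed (auto simp: U_def)
  moreover have "N U \<le> R"
  proof -
    have "N U \<le> (\<Sum>i=1..H. norm (U i))" using p by (intro norm_p2_le_sum) auto
    also have "\<dots> = (\<Sum>i<H. norm (\<Phi> (Suc i) - baseline A B K0 (Suc i)))"
      by (simp add: sum.atLeast1_atMost_eq U_def)
    also have "\<dots> \<le> (\<Sum>i. norm (\<Phi> (Suc i) - baseline A B K0 (Suc i)))"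
      by (intro sum_le_suminf summable) auto
    finally show ?thesis using le by simp
  qed
  ultimately show "U \<in> QB" by (simp add: Q_ball_def)
  show "traj w \<Phi> t = yb t U" if "t \<in> {1..T}" for t
    unfolding traj_def ybar_def using that by (intro sum.cong) (auto simp: U_def)
qed

section \<open>Summation over the rounds\<close>

definition "rate = exp 1 * L * W * R * sqrt (real T * (1 + 2 * \<xi> * \<Lambda>) * ln (exp 1 * real T))"

lemma rate_nonneg: "0 \<le> rate"
proof -
  have "1 \<le> exp 1 * real T"
    using T one_le_exp_iff[of 1] mult_mono[of 1 "exp 1" 1 "real T"] by simp
  then show ?thesis unfolding rate_def using L W R \<xi> \<Lambda> by (intro mult_nonneg_nonneg) auto
qed

lemma regret_against:
  assumes U: "U \<in> QB"
  shows "(\<Sum>t=1..T. c t (x t, u t) - c t (yb t U)) \<le> rate"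
proof (cases "R = 0")
  \<comment> \<open>The ball contains only the zero tuple, so the iterates equal the comparator and
    never move.\<close>
  case True
  have null: "X i = 0" if X: "X \<in> QB" for X i
  proof (cases "i \<in> {1..H}")
    case True
    have "N X \<le> 0" using X \<open>R = 0\<close> by (simp add: Q_ball_def)
    then have "N X = 0" using norm_p2_nonneg[of p H X] by linarith
    then show ?thesis using norm_p2_eq_0[of p H X i] p True by simp
  next
    case False
    then show ?thesis using ball_in_V[OF X] by (auto simp: V_space_def tuples_def)
  qed
  have Q_null: "Q t i = 0" if "t \<in> {1..T}" for t i
    by (rule null[OF Q_in_ball[OF that]])
  have "c t (x t, u t) - c t (yb t U) \<le> 0" if t: "t \<in> {1..T}" for t
  proof -
    have "Q t = U" using null[OF Q_in_ball[OF t]] null[OF U] by (simp add: fun_eq_iff)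
    moreover have "c t (x t, u t) - c t (yb t (Q t)) \<le> \<xi> * \<Lambda> * (L * W * 0)"
      by (rule played_cost_le[OF _ _ t]) (auto simp: Q_null)
    ultimately show ?thesis by simp
  qed
  then have "(\<Sum>t=1..T. c t (x t, u t) - c t (yb t U)) \<le> 0" by (rule sum_nonpos)
  then show ?thesis using rate_nonneg by simp
next
  case R0: False
  show ?thesis
  proof (cases "L * W = 0")
    \<comment> \<open>The step size is arbitrary here, so the diameter replaces the movement bound;
      both estimates carry the factor L W = 0.\<close>
    case True
    have "c t (x t, u t) - c t (yb t U) \<le> 0" if t: "t \<in> {1..T}" for t
    proof -
      have "c t (x t, u t) - c t (yb t (Q t)) \<le> \<xi> * \<Lambda> * (L * W * (2 * (a * R)))"
        using a R by (intro played_cost_le ball_diff_sum_le Q_in_ball t) auto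
      moreover have "tuple_inner H (g t) (\<lambda>i. Q t i - U i) \<le> M * N (\<lambda>i. Q t i - U i)"
        by (intro subgradient_dual_bound R0 t U Q_in_ball)
      ultimately show ?thesis using surrogate_cost_le[OF R0 t U] True by simp
    qed
    then have "(\<Sum>t=1..T. c t (x t, u t) - c t (yb t U)) \<le> 0" by (rule sum_nonpos)
    then show ?thesis using rate_nonneg by simp
  next
    case False
    define \<kappa> where "\<kappa> = 1 + 2 * \<xi> * \<Lambda>"
    define \<alpha> where "\<alpha> = p - 1"
    have \<alpha>: "\<alpha> > 0" "\<alpha> = 1 / ln (exp 1 * real H)"
      unfolding \<alpha>_def using p(1) by (simp, intro p(3))
    have \<kappa>: "\<kappa> \<ge> 1" using \<xi> \<Lambda> by (simp add: \<kappa>_def)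
    have "L * W > 0" using False L W by (simp add: less_le)
    then have Mp: "M > 0" using a(1) by (rule mult_pos_pos)
    have Rp: "R > 0" using R R0 by simp
    have Tp: "real T > 0" using T by simp
    define q where "q = sqrt (real T * \<kappa>)"
    have q: "q > 0" "q\<^sup>2 = real T * \<kappa>" using Tp \<kappa> by (simp_all add: q_def)
    have \<eta>: "\<eta> = R * sqrt \<alpha> / (M * q)"
      using step False by (simp add: step_size_def \<alpha>_def q_def \<kappa>_def kappa_def)
    then have \<eta>p: "\<eta> > 0" using Rp \<alpha> Mp q by simp
    note md = mirror_descent_step[OF H subset_trans[OF Q_ball_subset] Q_ball_convex[OF _ _ _ _ H]
        subgradient(2)[OF R0] Q_in_ball \<eta>p M subgradient_dual_bound[OF R0]]
    \<comment> \<open>The movement of one step in \<open>norm_p2\<close>, times a to pass to the l1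
      sum.\<close>
    define b where "b = a * (\<eta> * M / \<alpha>)"
    have b: "0 \<le> b" using a \<eta>p Mp \<alpha> by (simp add: b_def)
    have move: "(\<Sum>i=1..H. norm (Q t i - Q (Suc t) i)) \<le> b" if "1 \<le> t" "t < T" for t
    proof -
      have t: "t \<in> {1..T}" using that by auto
      have "N (\<lambda>i. Q (Suc t) i - Q t i) \<le> \<eta> * M / \<alpha>"
        unfolding \<alpha>_def by (rule md(1)) (use t in auto)
      then have "a * N (\<lambda>i. Q t i - Q (Suc t) i) \<le> b"
        unfolding b_def norm_p2_minus_commute[of p H "Q t"] using a by (intro mult_left_mono) auto
      then show ?thesis using diff_sum_le[of "Q t" "Q (Suc t)"] by linarith
    qed
    have round: "c t (x t, u t) - c t (yb t U)
        \<le> (bregman H U (Q t) - bregman H U (Q (Suc t))) / \<eta> + \<eta> * M\<^sup>2 * \<kappa> / (2 * \<alpha>)"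
      if t: "t \<in> {1..T}" for t
    proof -
      have "c t (x t, u t) - c t (yb t (Q t)) \<le> \<xi> * \<Lambda> * (L * W * b)"
        by (rule played_cost_le[OF move b t])
      \<comment> \<open>Since L W a = M, tracking costs 2 \<xi> \<Lambda> times the mirror descent
        error; adding that error yields the factor \<kappa>.\<close>
      also have "\<dots> = \<eta> * M\<^sup>2 * (2 * \<xi> * \<Lambda>) / (2 * \<alpha>)"
        by (simp add: b_def power2_eq_square mult_ac)
      finally have "c t (x t, u t) - c t (yb t (Q t)) \<le> \<eta> * M\<^sup>2 * (2 * \<xi> * \<Lambda>) / (2 * \<alpha>)" .
      moreover have "tuple_inner H (g t) (\<lambda>i. Q t i - U i)
          \<le> (bregman H U (Q t) - bregman H U (Q (Suc t))) / \<eta> + \<eta> * M\<^sup>2 / (2 * \<alpha>)"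
        unfolding \<alpha>_def by (rule md(2)) (use t U in auto)
      moreover have "\<eta> * M\<^sup>2 * \<kappa> / (2 * \<alpha>) = \<eta> * M\<^sup>2 / (2 * \<alpha>) + \<eta> * M\<^sup>2 * (2 * \<xi> * \<Lambda>) / (2 * \<alpha>)"
        by (simp add: \<kappa>_def distrib_left add_divide_distrib)
      ultimately show ?thesis using surrogate_cost_le[OF R0 t U] by linarith
    qed
    \<comment> \<open>Used with m = M and s = sqrt \<alpha>: the prescribed \<eta> makes the
      accumulated error and the initial divergence equal, each half of the bound.\<close>
    have balance: "R * s / (m * q) * m\<^sup>2 * q\<^sup>2 / (2 * s\<^sup>2) = R * m * q / s / 2"
      "R\<^sup>2 / 2 / (R * s / (m * q)) = R * m * q / s / 2" if "m > 0" "q > 0" "s > 0" for m q s :: real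
      using that Rp by (simp_all add: power2_eq_square)
    have "(\<Sum>t=1..T. bregman H U (Q t) - bregman H U (Q (Suc t)))
        = bregman H U (Q 1) - bregman H U (Q (Suc T))"
      using sum_Suc_diff[of 1 T "\<lambda>t. - bregman H U (Q t)"] by simp
    also have "\<dots> \<le> R\<^sup>2 / 2"
    proof -
      \<comment> \<open>The final iterate is beyond the range of \<open>Q_in_ball\<close>; it is
        feasible as the minimiser of round T.\<close>
      have "Q (Suc T) \<in> QB" using subgradient(2)[OF R0, of T] T by (simp add: is_arg_min_def)
      then have "Q (Suc T) \<in> tuples H" "U \<in> tuples H" using U Q_ball_subset by blast+
      then have "(p - 1) / 2 * (N (\<lambda>i. U i - Q (Suc T) i))\<^sup>2 \<le> bregman H U (Q (Suc T))"
        by (rule bregman_strongly_convex[OF H])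
      moreover have "0 \<le> (p - 1) / 2 * (N (\<lambda>i. U i - Q (Suc T) i))\<^sup>2" using p(1) by simp
      moreover have "bregman H U (Q 1) \<le> R\<^sup>2 / 2"
        unfolding Q1 bregman_zero[OF H] using U
        by (intro divide_right_mono power_mono) (auto simp: Q_ball_def)
      ultimately show ?thesis by linarith
    qed
    finally have telescope: "(\<Sum>t=1..T. bregman H U (Q t) - bregman H U (Q (Suc t))) \<le> R\<^sup>2 / 2" .
    have "(\<Sum>t=1..T. c t (x t, u t) - c t (yb t U))
        \<le> (\<Sum>t=1..T. (bregman H U (Q t) - bregman H U (Q (Suc t))) / \<eta> + \<eta> * M\<^sup>2 * \<kappa> / (2 * \<alpha>))"
      by (intro sum_mono round)
    also have "\<dots> = (\<Sum>t=1..T. bregman H U (Q t) - bregman H U (Q (Suc t))) / \<eta>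
        + real T * (\<eta> * M\<^sup>2 * \<kappa> / (2 * \<alpha>))"
      by (simp add: sum.distrib flip: sum_divide_distrib)
    also have "\<dots> \<le> R\<^sup>2 / 2 / \<eta> + real T * (\<eta> * M\<^sup>2 * \<kappa> / (2 * \<alpha>))"
      using telescope \<eta>p by (intro add_right_mono divide_right_mono) auto
    also have "real T * (\<eta> * M\<^sup>2 * \<kappa> / (2 * \<alpha>)) = R * M * q / sqrt \<alpha> / 2"
    proof -
      have "real T * (\<eta> * M\<^sup>2 * \<kappa> / (2 * \<alpha>)) = \<eta> * M\<^sup>2 * q\<^sup>2 / (2 * (sqrt \<alpha>)\<^sup>2)"
        using q(2) \<alpha>(1) by simp
      also have "\<dots> = R * M * q / sqrt \<alpha> / 2"
        unfolding \<eta> by (rule balance(1)) (use Mp q(1) \<alpha>(1) in auto)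
      finally show ?thesis .
    qed
    also have "R\<^sup>2 / 2 / \<eta> = R * M * q / sqrt \<alpha> / 2"
      unfolding \<eta> by (rule balance(2)) (use Mp q(1) \<alpha>(1) in auto)
    finally have "(\<Sum>t=1..T. c t (x t, u t) - c t (yb t U)) \<le> R * M * q / sqrt \<alpha>"
      by (simp only: field_sum_of_halves)
    also have "\<dots> = L * W * R * a * (q * sqrt (ln (exp 1 * real H)))"
      by (simp add: \<alpha>(2) real_sqrt_divide mult_ac)
    also have "\<dots> \<le> L * W * R * exp 1 * (q * sqrt (ln (exp 1 * real T)))"
    proof -
      have "ln (exp 1 * real H) \<le> ln (exp 1 * real T)" using H by (subst ln_le_cancel_iff) auto
      moreover have "0 \<le> ln (exp 1 * real H)" using \<alpha> by (simp add: less_imp_le)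
      ultimately show ?thesis
        using L W R a q by (intro mult_mono real_sqrt_le_mono mult_nonneg_nonneg) auto
    qed
    also have "\<dots> = rate" by (simp add: rate_def q_def \<kappa>_def real_sqrt_mult)
    finally show ?thesis .
  qed
qed

lemma regret_le: "regret A B K0 T R c w x u \<le> rate"
proof -
  \<comment> \<open>Witness of nonemptiness, required by \<open>cINF_greatest\<close>.\<close>
  have "baseline A B K0 \<in> response_ball A B K0 R"
    using R by (simp add: response_ball_def baseline_response)
  then have "(\<Sum>t=1..T. c t (x t, u t)) - rate
      \<le> (INF \<Phi>\<in>response_ball A B K0 R. \<Sum>t=1..T. c t (traj w \<Phi> t))"
  proof (intro cINF_greatest)
    fix \<Phi> assume "\<Phi> \<in> response_ball A B K0 R"
    then obtain U where U: "U \<in> QB" "\<And>t. t \<in> {1..T} \<Longrightarrow> traj w \<Phi> t = yb t U"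
      by (rule comparator) (rule that, assumption, blast)
    then show "(\<Sum>t=1..T. c t (x t, u t)) - rate \<le> (\<Sum>t=1..T. c t (traj w \<Phi> t))"
      using regret_against[OF U(1)] by (simp add: sum_subtractf)
  qed auto
  then show ?thesis by (simp add: regret_def)
qed

end

section \<open>Instantiation for the two cost classes\<close>

lemma tracked_descent_regret:
  assumes "tracked_descent A B K0 T R W L \<eta> c w x u Q g"
  shows "regret A B K0 T R c w x u
    \<le> exp 1 * L * W * R * sqrt (real T * (1 + 2 * chi0 K0 * Lambda_x A B K0) * ln (exp 1 * real T))"
  using tracked_descent.regret_le[OF assms] unfolding tracked_descent.rate_def[OF assms] .

text \<open>Places the origin in the ball of regularity, where the gradient bound forces L \<ge>
  0.\<close>

lemma D_R_nonneg:
  assumes "Lambda_finite A B K0" "0 \<le> W" "0 \<le> R"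
  shows "0 \<le> D_R A B K0 W R"
proof -
  have "0 \<le> S0 A B K0" unfolding S0_def by (intro suminf_nonneg summable_baseline_norm assms) auto
  moreover have "0 \<le> exp 1 * R * kappa A B K0" using kappa_ge_1[OF assms(1)] assms by simp
  ultimately show ?thesis using assms by (simp add: D_R_def)
qed

theorem theorem5p5:
  fixes A :: "real ^ 'x::finite ^ 'x"
    and B :: "real ^ 'u::finite ^ 'x"
    and K0 :: "real ^ 'x ^ 'u"
    and T :: nat
    and R W L G \<eta> :: real
    and c :: "nat \<Rightarrow> (real ^ 'x) \<times> (real ^ 'u) \<Rightarrow> real"
    and w x :: "nat \<Rightarrow> real ^ 'x"
    and u :: "nat \<Rightarrow> real ^ 'u"
    and Q g :: "nat \<Rightarrow> nat \<Rightarrow> ('x, 'u) block"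
  assumes "T \<ge> 2" and "R \<ge> 0"
    and "Lambda_finite A B K0"
    and "\<forall>t\<in>{1..T}. norm (w t) \<le> W"
    and "step_size A B K0 T L W R \<eta>"
    and "algorithm_run A B K0 T R \<eta> c w x u Q g"
  shows "((\<forall>t\<in>{1..T}. convex_on UNIV (c t) \<and> L-lipschitz_on UNIV (c t)) \<longrightarrow>
            regret A B K0 T R c w x u
              \<le> exp 1 * L * W * R *
                 sqrt (real T * (1 + 2 * chi0 K0 * Lambda_x A B K0) * ln (exp 1 * real T))) \<and>
         ((\<forall>t\<in>{1..T}. regular_cost G (D_R A B K0 W R) (c t)) \<and> L = G * D_R A B K0 W R \<longrightarrow>
            regret A B K0 T R c w x u
              \<le> exp 1 * L * W * R *
                 sqrt (real T * (1 + 2 * chi0 K0 * Lambda_x A B K0) * ln (exp 1 * real T)))"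
proof (intro conjI impI)
  have one: "1 \<in> {1..T}" using assms(1) by simp
  assume costs: "\<forall>t\<in>{1..T}. convex_on UNIV (c t) \<and> L-lipschitz_on UNIV (c t)"
  have "tracked_descent A B K0 T R W L \<eta> c w x u Q g"
  proof
    show "0 \<le> L" using costs one lipschitz_on_nonneg by blast
    show "slope_bounded L (c t) y" if "t \<in> {1..T}" for t y
      using costs that by (intro slope_bounded_lipschitz) auto
  qed (use assms costs in auto)
  then show "regret A B K0 T R c w x u
      \<le> exp 1 * L * W * R *
         sqrt (real T * (1 + 2 * chi0 K0 * Lambda_x A B K0) * ln (exp 1 * real T))"
    by (rule tracked_descent_regret)
next
  have one: "1 \<in> {1..T}" using assms(1) by simp
  assume costs: "(\<forall>t\<in>{1..T}. regular_cost G (D_R A B K0 W R) (c t)) \<and> L = G * D_R A B K0 W R"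
  have W: "0 \<le> W" using assms(4) one norm_ge_zero order_trans by blast
  have D: "0 \<le> D_R A B K0 W R" using D_R_nonneg[OF assms(3) W assms(2)] .
  have gradient: "\<exists>g. GDERIV (c t) y :> g \<and> norm g \<le> L"
    if "t \<in> {1..T}" "norm y \<le> D_R A B K0 W R" for t y
    using costs that by (auto simp: regular_cost_def)
  have "tracked_descent A B K0 T R W L \<eta> c w x u Q g"
  proof
    obtain z where "norm (z :: (real ^ 'x) \<times> (real ^ 'u)) \<le> L" using gradient[OF one, of 0] D by auto
    then show "0 \<le> L" by (rule order_trans[OF norm_ge_zero])
    show "slope_bounded L (c t) y" if "t \<in> {1..T}" "norm y \<le> D_R A B K0 W R" for t y
      using gradient[OF that] slope_bounded_GDERIV by blast
  qed (use assms costs in \<open>auto simp: regular_cost_def\<close>)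
  then show "regret A B K0 T R c w x u
      \<le> exp 1 * L * W * R *
         sqrt (real T * (1 + 2 * chi0 K0 * Lambda_x A B K0) * ln (exp 1 * real T))"
    by (rule tracked_descent_regret)
qed

end
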